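(* Assume that $(H_\Phi)$, $(H_T)$ and $(H_C)$ (stated in the context) hold and suppose that $C\cap\mathrm{icordom}\,\Lambda_0^*\neq\emptyset$. Then the following statements hold true. (a) The primal problem $(P)$ is attained in $\mathcal{L}_1$ and the dual problem $(D_2)$ is attained in $\mathcal{X}_1^{\mathrm{alg}}$. (b) Any $\bar\ell\in\mathcal{L}_1$ is a solution to $(P)$ if and only if there exists $\bar\omega\in\mathcal{X}_1^{\mathrm{alg}}$ such that the following three statements hold: (1) $T\bar\ell\in C$; (2) $\langle T\bar\ell,\bar\omega\rangle\le\langle x,\bar\omega\rangle$ for all $x\in C_1$; (3) $\bar\ell\in\partial_{\mathcal{L}_1}\Phi_2(T_2^*\bar\omega)$. Moreover, these three statements hold if and only if: $\bar\ell$ is a solution to $(P)$, $\bar\omega$ is a solution to $(D_2)$ and $\inf(P)=\sup(D_2)$. The representation formula (3) is equivalent to Young's identity $\Phi^*(\bar\ell)+\Phi_2(T_2^*\bar\omega)=\langle T\bar\ell,\bar\omega\rangle$. (c) Any solution $\bar\omega$ of $(D_2)$ shares the following properties: (1) $\bar\omega$ lies in the $\sigma(\mathcal{X}_1^{\mathrm{alg}},\mathcal{X}_1)$-closure of $\mathrm{dom}\,\Lambda_1$; (2) $T_2^*\bar\omega$ lies in the $\sigma(\mathcal{L}_1^{\mathrm{alg}},\mathcal{L}_1)$-closures of $T_1^*(\mathrm{dom}\,\Lambda_1)$ and of $\mathrm{dom}\,\Phi$; (3) for any $x_o\in C\cap\mathrm{icordom}\,\Lambda_1^*$, $\bar\omega$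 is $j_{D_{x_o}}$-upper semicontinuous and $j_{-D_{x_o}}$-lower semicontinuous at $0$, where $j_{D_{x_o}}$ and $j_{-D_{x_o}}$ are the gauge functionals on $\mathcal{X}_1$ of the convex sets $D_{x_o}=\{x\in\mathcal{X}_1;\Lambda_0^*(x_o+x)\le\Lambda_0^*(x_o)+1\}$ and $-D_{x_o}$.
   Context: All vector spaces are real. $E^{\mathrm{alg}}$ denotes the algebraic dual of $E$; $\sigma(E,F)$ is the weak topology on $E$ given by a dual pairing with $F$; $\mathrm{dom}\,f=\{f<+\infty\}$; $\mathrm{icordom}\,f$ is the intrinsic core of $\mathrm{dom}\,f$, i.e. the set of $x\in\mathrm{dom}\,f$ such that for every $x'$ in the affine hull of $\mathrm{dom}\,f$ there is $t>0$ with $[x,x+t(x'-x)]\subset\mathrm{dom}\,f$. Data. $\mathcal{U},\mathcal{Y}$ are vector spaces, $\mathcal{L}=\mathcal{U}^{\mathrm{alg}}$, $\mathcal{X}=\mathcal{Y}^{\mathrm{alg}}$, $\Phi$ is a function on $\mathcal{U}$, $T:\mathcal{L}\to\mathcal{X}$ is linear, $C\subset\mathcal{X}$ is convex. The adjoint $T^*:\mathcal{Y}\to\mathcal{L}^{\mathrm{alg}}$ is given by $\langle T^*y,\ell\rangle=\langle y,T\ell\rangle$; $\mathcal{U}$ is identified with a subspace of $\mathcal{L}^{\mathrm{alg}}$. Hypotheses. $(H_\Phi)$: (1) $\Phi:\mathcal{U}\to[0,+\infty]$ is convex and $\Phi(0)=0$; (2) for all $u\in\mathcal{U}$ there is $\alpha>0$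 with $\Phi(\alpha u)<\infty$; (3) for all $u\in\mathcal{U}$, $u\neq0$, there is $t\in\mathbb{R}$ with $\Phi(tu)>0$. $(H_T)$: (1) $T^*(\mathcal{Y})\subset\mathcal{U}$; (2) $\ker T^*=\{0\}$. $(H_C)$: $C_1:=C\cap\mathcal{X}_1$ is a convex $\sigma(\mathcal{X}_1,\mathcal{Y}_1)$-closed subset of $\mathcal{X}_1$. Norms and spaces. $\Phi_\pm(u)=\max(\Phi(u),\Phi(-u))$ and $|u|_\Phi=\inf\{\alpha>0;\Phi_\pm(u/\alpha)\le1\}$, a norm on $\mathcal{U}$. $\Lambda(y)=\Phi(T^*y)$, $\Lambda_\pm(y)=\max(\Lambda(y),\Lambda(-y))$, $|y|_\Lambda=\inf\{\alpha>0;\Lambda_\pm(y/\alpha)\le1\}=|T^*y|_\Phi$, a norm on $\mathcal{Y}$. $\mathcal{U}_1$ is the $|\cdot|_\Phi$-completion of $\mathcal{U}$ and $\mathcal{L}_1=(\mathcal{U},|\cdot|_\Phi)'\cong\mathcal{U}_1'$ its topological dual, seen as a subspace of $\mathcal{L}$. $\mathcal{Y}_1$ is the $|\cdot|_\Lambda$-completion of $\mathcal{Y}$ and $\mathcal{X}_1=(\mathcal{Y},|\cdot|_\Lambda)'\cong\mathcal{Y}_1'$, seen as a subspace of $\mathcal{X}$. Operators. One has $T\mathcal{L}_1\subset\mathcal{X}_1$. $T_2^*:\mathcal{X}_1^{\mathrm{alg}}\to\mathcal{L}_1^{\mathrm{alg}}$ is defined by $\langle\ell,T_2^*\omega\rangle=\langle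 T\ell,\omega\rangle$ for all $\ell\in\mathcal{L}_1$, and $T_1^*$ is its restriction to $\mathcal{Y}_1\subset\mathcal{X}_1^{\mathrm{alg}}$; one has $T_1^*\mathcal{Y}_1\subset\mathcal{U}_1$. Functions. $\Phi^*(\ell)=\sup_{u\in\mathcal{U}}\{\langle u,\ell\rangle-\Phi(u)\}$ for $\ell\in\mathcal{L}$. $\Phi_0(u)=\sup_{\ell\in\mathcal{L}}\{\langle u,\ell\rangle-\Phi^*(\ell)\}$ on $\mathcal{U}$; $\Phi_1(u)=\sup_{\ell\in\mathcal{L}_1}\{\langle u,\ell\rangle-\Phi^*(\ell)\}$ on $\mathcal{U}_1$; $\Phi_2(\zeta)=\sup_{\ell\in\mathcal{L}_1}\{\langle\ell,\zeta\rangle-\Phi^*(\ell)\}$ on $\mathcal{L}_1^{\mathrm{alg}}$. $\Lambda_0(y)=\Phi_0(T^*y)$ on $\mathcal{Y}$; $\Lambda_1(y)=\Phi_1(T_1^*y)$ on $\mathcal{Y}_1$; $\Lambda_2(\omega)=\Phi_2(T_2^*\omega)$ on $\mathcal{X}_1^{\mathrm{alg}}$. $\Lambda_0^*(x)=\sup_{y\in\mathcal{Y}}\{\langle y,x\rangle-\Lambda_0(y)\}$ on $\mathcal{X}$; $\Lambda_1^*(x)=\sup_{y\in\mathcal{Y}_1}\{\langle y,x\rangle-\Lambda_1(y)\}$ on $\mathcal{X}_1$. Subdifferential: $\ell\in\partial_{\mathcal{L}_1}\Phi_2(\zeta)$ means $\ell\in\mathcal{L}_1$ and $\Phi_2(\zeta+\xi)\ge\Phi_2(\zeta)+\langle\ell,\xi\rangle$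 for all $\xi\in\mathcal{L}_1^{\mathrm{alg}}$. Problems. $(P)$: minimize $\Phi^*(\ell)$ subject to $T\ell\in C$, $\ell\in\mathcal{L}$. $(D_2)$: maximize $\inf_{x\in C_1}\langle x,\omega\rangle-\Lambda_2(\omega)$, $\omega\in\mathcal{X}_1^{\mathrm{alg}}$. The gauge of a convex set $D$ containing $0$ is $j_D(x)=\inf\{\alpha>0;x\in\alpha D\}\in[0,\infty]$. A linear form $\omega$ is $j$-upper (resp. $j$-lower) semicontinuous at $0$ if for every $\varepsilon>0$ there is $\delta>0$ such that $j(x)<\delta$ implies $\langle\omega,x\rangle<\varepsilon$ (resp. $\langle\omega,x\rangle>-\varepsilon$). *)

theory Defs
  imports "HOL-Analysis.Analysis"
begin

section \<open>Algebraic duals\<close>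

typedef (overloaded) 'a alg_dual = "{f :: 'a::real_vector \<Rightarrow> real. linear f}"
  morphisms form Abs_alg_dual
  by (auto intro: exI[of _ "\<lambda>_. 0"] simp: linear_iff)

setup_lifting type_definition_alg_dual

instantiation alg_dual :: (real_vector) real_vector
begin

lift_definition zero_alg_dual :: "'a alg_dual" is "\<lambda>_. 0"
  by (simp add: linear_iff)

lift_definition plus_alg_dual :: "'a alg_dual \<Rightarrow> 'a alg_dual \<Rightarrow> 'a alg_dual"
  is "\<lambda>f g u. f u + g u"
  by (simp add: linear_iff algebra_simps)

lift_definition minus_alg_dual :: "'a alg_dual \<Rightarrow> 'a alg_dual \<Rightarrow> 'a alg_dual"
  is "\<lambda>f g u. f u - g u"
  by (simp add: linear_iff algebra_simps)

lift_definition uminus_alg_dual :: "'a alg_dual \<Rightarrow> 'a alg_dual" is "\<lambda>f u. - f u"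
  by (simp add: linear_iff)

lift_definition scaleR_alg_dual :: "real \<Rightarrow> 'a alg_dual \<Rightarrow> 'a alg_dual"
  is "\<lambda>r f u. r * f u"
  by (simp add: linear_iff algebra_simps)

instance
  by standard (transfer; simp add: fun_eq_iff algebra_simps)+

end

text \<open>
  The algebraic dual of a linear subspace \<open>S\<close>.  The subspaces that matter (\<open>L1\<close>, \<open>X1\<close> below)
  depend on term parameters and so are sets; a linear form on \<open>S\<close> is represented by its unique
  extension that is \<open>undefined\<close> off \<open>S\<close>.
\<close>

definition alg_dual_on :: "'v::real_vector set \<Rightarrow> ('v \<Rightarrow> real) set" where
  "alg_dual_on S = {\<zeta> \<in> extensional S.
     (\<forall>x\<in>S. \<forall>y\<in>S. \<zeta> (x + y) = \<zeta> x + \<zeta> y) \<and> (\<forall>a. \<forall>x\<in>S. \<zeta> (a *\<^sub>R x) = a * \<zeta> x)}"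

definition eval_on :: "'a::real_vector alg_dual set \<Rightarrow> 'a \<Rightarrow> 'a alg_dual \<Rightarrow> real" where
  "eval_on S u = (\<lambda>l\<in>S. form l u)"

section \<open>Generic notions\<close>

definition dom_on :: "'a set \<Rightarrow> ('a \<Rightarrow> ereal) \<Rightarrow> 'a set" where
  "dom_on A f = {a \<in> A. f a < \<infinity>}"

definition icor :: "'v::real_vector set \<Rightarrow> 'v set" where
  "icor D = {x \<in> D. \<forall>x' \<in> affine hull D. \<exists>t>0. closed_segment x (x + t *\<^sub>R (x' - x)) \<subseteq> D}"

definition fenchel_conj :: "'a set \<Rightarrow> ('a \<Rightarrow> 'b \<Rightarrow> real) \<Rightarrow> ('a \<Rightarrow> ereal) \<Rightarrow> 'b \<Rightarrow> ereal" where
  "fenchel_conj A p f b = (SUP a\<in>A. ereal (p a b) - f a)"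

text \<open>\<open>\<sigma>(E,F)\<close>: the initial topology on \<open>E\<close> for the maps \<open>x \<mapsto> p x y\<close>, \<open>y \<in> F\<close>.\<close>

definition weak_topology :: "'a set \<Rightarrow> 'b set \<Rightarrow> ('a \<Rightarrow> 'b \<Rightarrow> real) \<Rightarrow> 'a topology" where
  "weak_topology E F p = pullback_topology E (\<lambda>x. \<lambda>y\<in>F. p x y) (powertop_real F)"

definition gauge_of :: "'v::real_vector set \<Rightarrow> 'v \<Rightarrow> ereal" where
  "gauge_of D x = (INF \<alpha> \<in> {\<alpha>::real. \<alpha> > 0 \<and> x \<in> (\<lambda>d. \<alpha> *\<^sub>R d) ` D}. ereal \<alpha>)"

definition usc_at_0 :: "'v set \<Rightarrow> ('v \<Rightarrow> ereal) \<Rightarrow> ('v \<Rightarrow> real) \<Rightarrow> bool" where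
  "usc_at_0 E j \<omega> \<longleftrightarrow> (\<forall>\<epsilon>>0. \<exists>\<delta>::real>0. \<forall>x\<in>E. j x < ereal \<delta> \<longrightarrow> \<omega> x < \<epsilon>)"

definition lsc_at_0 :: "'v set \<Rightarrow> ('v \<Rightarrow> ereal) \<Rightarrow> ('v \<Rightarrow> real) \<Rightarrow> bool" where
  "lsc_at_0 E j \<omega> \<longleftrightarrow> (\<forall>\<epsilon>>0. \<exists>\<delta>::real>0. \<forall>x\<in>E. j x < ereal \<delta> \<longrightarrow> \<omega> x > - \<epsilon>)"

section \<open>Norm, topological dual and completion attached to a convex function\<close>

definition lux_norm :: "('a::real_vector \<Rightarrow> ereal) \<Rightarrow> 'a \<Rightarrow> real" where
  "lux_norm F u = Inf {\<alpha>::real. \<alpha> > 0 \<and> max (F (u /\<^sub>R \<alpha>)) (F (- (u /\<^sub>R \<alpha>))) \<le> 1}"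

definition lux_dist :: "('a::real_vector \<Rightarrow> ereal) \<Rightarrow> 'a \<Rightarrow> 'a \<Rightarrow> real" where
  "lux_dist F u v = lux_norm F (u - v)"

definition top_dual :: "('a::real_vector \<Rightarrow> ereal) \<Rightarrow> 'a alg_dual set" where
  "top_dual F = {l. continuous_map (Metric_space.mtopology UNIV (lux_dist F)) euclideanreal (form l)}"

text \<open>
  The completion, realised inside the algebraic dual of the topological dual: a Cauchy sequence
  \<open>\<sigma>\<close> is identified with the form \<open>l \<mapsto> lim l (\<sigma> n)\<close>.  Since the topological dual separates the
  points of the completion, sequences give the same form iff they have the same limit there.
\<close>

definition completion :: "('a::real_vector \<Rightarrow> ereal) \<Rightarrow> ('a alg_dual \<Rightarrow> real) set" where
  "completion F = {\<zeta> \<in> alg_dual_on (top_dual F).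
     \<exists>\<sigma>. Metric_space.MCauchy UNIV (lux_dist F) \<sigma> \<and>
         (\<forall>l\<in>top_dual F. (\<lambda>n. form l (\<sigma> n)) \<longlonglongrightarrow> \<zeta> l)}"

section \<open>The data of the problem\<close>

type_synonym ('u, 'y) dual_op = "'u alg_dual \<Rightarrow> 'y alg_dual"

text \<open>The adjoint with values in the algebraic dual of \<open>'u alg_dual\<close>, and, when it takes its
  values in the image of \<open>'u\<close> there, the adjoint with values in \<open>'u\<close>.\<close>

definition T_adj :: "('u::real_vector, 'y::real_vector) dual_op \<Rightarrow> 'y \<Rightarrow> 'u alg_dual \<Rightarrow> real" where
  "T_adj T y = (\<lambda>l. form (T l) y)"

definition T_adj_U :: "('u::real_vector, 'y::real_vector) dual_op \<Rightarrow> 'y \<Rightarrow> 'u" where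
  "T_adj_U T y = (THE u. eval_on UNIV u = T_adj T y)"

definition H_Phi :: "('u::real_vector \<Rightarrow> ereal) \<Rightarrow> bool" where
  "H_Phi \<Phi> \<longleftrightarrow>
     (\<forall>u. 0 \<le> \<Phi> u) \<and>
     (\<forall>u v. \<forall>t\<in>{0..1}. \<Phi> ((1 - t) *\<^sub>R u + t *\<^sub>R v) \<le> ereal (1 - t) * \<Phi> u + ereal t * \<Phi> v) \<and>
     \<Phi> 0 = 0 \<and>
     (\<forall>u. \<exists>\<alpha>>0. \<Phi> (\<alpha> *\<^sub>R u) < \<infinity>) \<and>
     (\<forall>u. u \<noteq> 0 \<longrightarrow> (\<exists>t. \<Phi> (t *\<^sub>R u) > 0))"

definition H_T :: "('u::real_vector, 'y::real_vector) dual_op \<Rightarrow> bool" where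
  "H_T T \<longleftrightarrow> range (T_adj T) \<subseteq> range (eval_on UNIV) \<and> {y. T_adj T y = (\<lambda>_. 0)} = {0}"

definition Lam :: "('u::real_vector \<Rightarrow> ereal) \<Rightarrow> ('u, 'y::real_vector) dual_op \<Rightarrow> 'y \<Rightarrow> ereal" where
  "Lam \<Phi> T y = \<Phi> (T_adj_U T y)"

definition L1 :: "('u::real_vector \<Rightarrow> ereal) \<Rightarrow> 'u alg_dual set" where
  "L1 \<Phi> = top_dual \<Phi>"

definition U1 :: "('u::real_vector \<Rightarrow> ereal) \<Rightarrow> ('u alg_dual \<Rightarrow> real) set" where
  "U1 \<Phi> = completion \<Phi>"

definition X1 :: "('u::real_vector \<Rightarrow> ereal) \<Rightarrow> ('u, 'y::real_vector) dual_op \<Rightarrow> 'y alg_dual set" where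
  "X1 \<Phi> T = top_dual (Lam \<Phi> T)"

definition Y1 :: "('u::real_vector \<Rightarrow> ereal) \<Rightarrow> ('u, 'y::real_vector) dual_op \<Rightarrow> ('y alg_dual \<Rightarrow> real) set" where
  "Y1 \<Phi> T = completion (Lam \<Phi> T)"

definition L1_alg :: "('u::real_vector \<Rightarrow> ereal) \<Rightarrow> ('u alg_dual \<Rightarrow> real) set" where
  "L1_alg \<Phi> = alg_dual_on (L1 \<Phi>)"

definition X1_alg :: "('u::real_vector \<Rightarrow> ereal) \<Rightarrow> ('u, 'y::real_vector) dual_op \<Rightarrow> ('y alg_dual \<Rightarrow> real) set" where
  "X1_alg \<Phi> T = alg_dual_on (X1 \<Phi> T)"

definition T2_adj :: "('u::real_vector \<Rightarrow> ereal) \<Rightarrow> ('u, 'y::real_vector) dual_op \<Rightarrow>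
    ('y alg_dual \<Rightarrow> real) \<Rightarrow> 'u alg_dual \<Rightarrow> real" where
  "T2_adj \<Phi> T \<omega> = (\<lambda>l\<in>L1 \<Phi>. \<omega> (T l))"

definition T1_adj :: "('u::real_vector \<Rightarrow> ereal) \<Rightarrow> ('u, 'y::real_vector) dual_op \<Rightarrow>
    ('y alg_dual \<Rightarrow> real) \<Rightarrow> 'u alg_dual \<Rightarrow> real" where
  "T1_adj \<Phi> T = restrict (T2_adj \<Phi> T) (Y1 \<Phi> T)"

definition C1 :: "('u::real_vector \<Rightarrow> ereal) \<Rightarrow> ('u, 'y::real_vector) dual_op \<Rightarrow> 'y alg_dual set \<Rightarrow> 'y alg_dual set" where
  "C1 \<Phi> T C = C \<inter> X1 \<Phi> T"

definition H_C :: "('u::real_vector \<Rightarrow> ereal) \<Rightarrow> ('u, 'y::real_vector) dual_op \<Rightarrow> 'y alg_dual set \<Rightarrow> bool" where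
  "H_C \<Phi> T C \<longleftrightarrow> convex (C1 \<Phi> T C) \<and>
     closedin (weak_topology (X1 \<Phi> T) (Y1 \<Phi> T) (\<lambda>x y. y x)) (C1 \<Phi> T C)"

section \<open>Conjugates and extensions\<close>

definition Phi_conj :: "('u::real_vector \<Rightarrow> ereal) \<Rightarrow> 'u alg_dual \<Rightarrow> ereal" where
  "Phi_conj \<Phi> = fenchel_conj UNIV (\<lambda>u l. form l u) \<Phi>"

definition Phi0 :: "('u::real_vector \<Rightarrow> ereal) \<Rightarrow> 'u \<Rightarrow> ereal" where
  "Phi0 \<Phi> = fenchel_conj UNIV form (Phi_conj \<Phi>)"

text \<open>\<open>Phi1\<close> is meant on \<open>U1\<close>, \<open>Phi2\<close> on \<open>L1_alg\<close>; as \<open>U1\<close> is realised inside \<open>L1_alg\<close>, the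
  defining formulas coincide.\<close>

definition Phi1 :: "('u::real_vector \<Rightarrow> ereal) \<Rightarrow> ('u alg_dual \<Rightarrow> real) \<Rightarrow> ereal" where
  "Phi1 \<Phi> = fenchel_conj (L1 \<Phi>) (\<lambda>l u. u l) (Phi_conj \<Phi>)"

definition Phi2 :: "('u::real_vector \<Rightarrow> ereal) \<Rightarrow> ('u alg_dual \<Rightarrow> real) \<Rightarrow> ereal" where
  "Phi2 \<Phi> = fenchel_conj (L1 \<Phi>) (\<lambda>l \<zeta>. \<zeta> l) (Phi_conj \<Phi>)"

definition Lam0 :: "('u::real_vector \<Rightarrow> ereal) \<Rightarrow> ('u, 'y::real_vector) dual_op \<Rightarrow> 'y \<Rightarrow> ereal" where
  "Lam0 \<Phi> T y = Phi0 \<Phi> (T_adj_U T y)"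

definition Lam1 :: "('u::real_vector \<Rightarrow> ereal) \<Rightarrow> ('u, 'y::real_vector) dual_op \<Rightarrow> ('y alg_dual \<Rightarrow> real) \<Rightarrow> ereal" where
  "Lam1 \<Phi> T y = Phi1 \<Phi> (T1_adj \<Phi> T y)"

definition Lam2 :: "('u::real_vector \<Rightarrow> ereal) \<Rightarrow> ('u, 'y::real_vector) dual_op \<Rightarrow> ('y alg_dual \<Rightarrow> real) \<Rightarrow> ereal" where
  "Lam2 \<Phi> T \<omega> = Phi2 \<Phi> (T2_adj \<Phi> T \<omega>)"

definition Lam0_conj :: "('u::real_vector \<Rightarrow> ereal) \<Rightarrow> ('u, 'y::real_vector) dual_op \<Rightarrow> 'y alg_dual \<Rightarrow> ereal" where
  "Lam0_conj \<Phi> T = fenchel_conj UNIV (\<lambda>y x. form x y) (Lam0 \<Phi> T)"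

definition Lam1_conj :: "('u::real_vector \<Rightarrow> ereal) \<Rightarrow> ('u, 'y::real_vector) dual_op \<Rightarrow> 'y alg_dual \<Rightarrow> ereal" where
  "Lam1_conj \<Phi> T = fenchel_conj (Y1 \<Phi> T) (\<lambda>y x. y x) (Lam1 \<Phi> T)"

definition subdiff_Phi2 :: "('u::real_vector \<Rightarrow> ereal) \<Rightarrow> ('u alg_dual \<Rightarrow> real) \<Rightarrow> 'u alg_dual set" where
  "subdiff_Phi2 \<Phi> \<zeta> = {l \<in> L1 \<Phi>. \<forall>\<xi>\<in>L1_alg \<Phi>.
     Phi2 \<Phi> (\<lambda>m\<in>L1 \<Phi>. \<zeta> m + \<xi> m) \<ge> Phi2 \<Phi> \<zeta> + ereal (\<xi> l)}"

section \<open>The optimization problems\<close>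

definition feasible_P :: "('u::real_vector, 'y::real_vector) dual_op \<Rightarrow> 'y alg_dual set \<Rightarrow> 'u alg_dual set" where
  "feasible_P T C = {l. T l \<in> C}"

definition inf_P :: "('u::real_vector \<Rightarrow> ereal) \<Rightarrow> ('u, 'y::real_vector) dual_op \<Rightarrow> 'y alg_dual set \<Rightarrow> ereal" where
  "inf_P \<Phi> T C = (INF l\<in>feasible_P T C. Phi_conj \<Phi> l)"

definition solution_P :: "('u::real_vector \<Rightarrow> ereal) \<Rightarrow> ('u, 'y::real_vector) dual_op \<Rightarrow> 'y alg_dual set \<Rightarrow> 'u alg_dual \<Rightarrow> bool" where
  "solution_P \<Phi> T C l \<longleftrightarrow> l \<in> feasible_P T C \<and> Phi_conj \<Phi> l = inf_P \<Phi> T C"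

definition objective_D2 :: "('u::real_vector \<Rightarrow> ereal) \<Rightarrow> ('u, 'y::real_vector) dual_op \<Rightarrow> 'y alg_dual set \<Rightarrow>
    ('y alg_dual \<Rightarrow> real) \<Rightarrow> ereal" where
  "objective_D2 \<Phi> T C \<omega> = (INF x\<in>C1 \<Phi> T C. ereal (\<omega> x)) - Lam2 \<Phi> T \<omega>"

definition sup_D2 :: "('u::real_vector \<Rightarrow> ereal) \<Rightarrow> ('u, 'y::real_vector) dual_op \<Rightarrow> 'y alg_dual set \<Rightarrow> ereal" where
  "sup_D2 \<Phi> T C = (SUP \<omega>\<in>X1_alg \<Phi> T. objective_D2 \<Phi> T C \<omega>)"

definition solution_D2 :: "('u::real_vector \<Rightarrow> ereal) \<Rightarrow> ('u, 'y::real_vector) dual_op \<Rightarrow> 'y alg_dual set \<Rightarrow>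
    ('y alg_dual \<Rightarrow> real) \<Rightarrow> bool" where
  "solution_D2 \<Phi> T C \<omega> \<longleftrightarrow> \<omega> \<in> X1_alg \<Phi> T \<and> objective_D2 \<Phi> T C \<omega> = sup_D2 \<Phi> T C"

definition level_set :: "('u::real_vector \<Rightarrow> ereal) \<Rightarrow> ('u, 'y::real_vector) dual_op \<Rightarrow> 'y alg_dual \<Rightarrow> 'y alg_dual set" where
  "level_set \<Phi> T x\<^sub>o = {x \<in> X1 \<Phi> T. Lam0_conj \<Phi> T (x\<^sub>o + x) \<le> Lam0_conj \<Phi> T x\<^sub>o + 1}"

end

theory Submission
  imports Defs
begin

text \<open>
  By convex Hahn--Banach extension along \<open>T\<^sup>*\<close>, the conjugate \<open>\<Lambda>\<^sub>0\<^sup>*\<close> equals \<open>\<Lambda>\<^sup>*\<close>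
  and \<open>\<Lambda>\<^sub>0\<^sup>* x = min {\<Phi>\<^sup>* l; T l = x}\<close>.  So \<open>(P)\<close> amounts to minimizing \<open>\<Lambda>\<^sub>0\<^sup>*\<close> over \<open>C\<^sub>1\<close>;
  the sublevel sets of \<open>\<Lambda>\<^sub>0\<^sup>*\<close> are \<open>\<sigma>(\<X>\<^sub>1, \<Y>\<^sub>1)\<close>-compact, whence attainment, and \<open>(D\<^sub>2)\<close> is the
  Fenchel dual with no topology on the multipliers.  The effective domain of \<open>\<Lambda>\<^sub>0\<^sup>*\<close> spans
  \<open>\<X>\<^sub>1\<close>, so the qualification hypothesis puts a point of \<open>C\<close> in the algebraic core of this
  domain relative to \<open>\<X>\<^sub>1\<close>, and an algebraic subgradient of the value function is a dual
  solution without duality gap.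
  Properties (c) use only \<open>\<Lambda>\<^sub>2 \<omega> < \<infinity>\<close>.
\<close>

section \<open>Algebraic extension and separation\<close>

text \<open>One tool replaces all separation theorems: the extension theorem below, a Hahn-Banach
  theorem for graphs lying under a convex epigraph. The epigraph is absorbing only in the algebraic
  sense and its function may take the value \<infinity>; this generality is forced, since an
  intrinsic core supplies no topological interior. For the same reason multipliers are sought among
  all linear forms on \<open>X1\<close>, with no claim of continuity. No lower semicontinuity of
  \<Phi> is available, so \<open>Phi0\<close> may lie strictly below \<Phi>. The arguments therefore
  run through the conjugates of \<Phi> and of \<open>Lam\<close>, which determine the bidual
  functions. Bounds have the shape \<open>Phi_conj F x \<le> ereal s\<close> with a real
  \<open>s\<close>, which keeps the arithmetic of convex combinations in the reals. The delicate
  point behind the qualification hypothesis is that a norm-continuous form is controlled only by the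
  symmetrized function, so its own conjugate can be infinite. It has to be split into a difference
  of two forms, each controlled by the one-sided function.\<close>

lemma convex_domination_extension:
  fixes E :: "('a::real_vector \<times> real) set"
  assumes E: "convex E" and G0: "subspace G0"
    and dom: "\<And>u a r. (u, a) \<in> G0 \<Longrightarrow> (u, r) \<in> E \<Longrightarrow> a \<le> r"
    and core: "\<And>u. \<exists>t>0. \<exists>r. (t *\<^sub>R u, r) \<in> E"
  obtains L where "linear L" "\<And>u a. (u, a) \<in> G0 \<Longrightarrow> L u = a" "\<And>u r. (u, r) \<in> E \<Longrightarrow> L u \<le> r"
proof -
  \<comment> \<open>Partial linear maps are kept as subspaces of the product that stay below
    \<open>E\<close>. Single-valuedness is not part of the definition: domination over the origin
    implies it (\<open>fun0\<close>), so the chain argument need not carry it.\<close>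
  define \<A> where "\<A> = {G. subspace G \<and> G0 \<subseteq> G \<and> (\<forall>u a r. (u, a) \<in> G \<longrightarrow> (u, r) \<in> E \<longrightarrow> a \<le> r)}"
  have "\<exists>G\<in>\<A>. \<forall>X\<in>\<A>. G \<subseteq> X \<longrightarrow> X = G"
  proof (rule subset_Zorn_nonempty)
    show "\<A> \<noteq> {}" using G0 dom by (auto simp: \<A>_def)
    fix \<C> assume ne: "\<C> \<noteq> {}" and ch: "subset.chain \<A> \<C>"
    have sub: "\<C> \<subseteq> \<A>" and lin: "\<And>X Y. X \<in> \<C> \<Longrightarrow> Y \<in> \<C> \<Longrightarrow> X \<subseteq> Y \<or> Y \<subseteq> X"
      using ch unfolding subset_chain_def by auto
    have "subspace (\<Union>\<C>)"
    proof (rule subspaceI)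
      show "0 \<in> \<Union>\<C>" using ne sub subspace_0 unfolding \<A>_def by blast
      show "x + y \<in> \<Union>\<C>" if xy: "x \<in> \<Union>\<C>" "y \<in> \<Union>\<C>" for x y
      proof -
        obtain X Y where XY: "X \<in> \<C>" "x \<in> X" "Y \<in> \<C>" "y \<in> Y" using xy by blast
        obtain Z where "Z \<in> \<C>" "x \<in> Z" "y \<in> Z" using lin[of X Y] XY by blast
        moreover from this have "subspace Z" using sub by (auto simp: \<A>_def)
        ultimately show ?thesis by (auto intro: subspace_add)
      qed
      show "c *\<^sub>R x \<in> \<Union>\<C>" if "x \<in> \<Union>\<C>" for c x
        using that sub by (auto simp: \<A>_def intro: subspace_mul)
    qed
    then show "\<Union>\<C> \<in> \<A>" using ne sub unfolding \<A>_def by blast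
  qed
  then obtain G where GA: "G \<in> \<A>" and max: "\<And>X. X \<in> \<A> \<Longrightarrow> G \<subseteq> X \<Longrightarrow> X = G" by blast
  have G: "subspace G" "G0 \<subseteq> G" and Gd: "\<And>u a r. (u, a) \<in> G \<Longrightarrow> (u, r) \<in> E \<Longrightarrow> a \<le> r"
    using GA by (auto simp: \<A>_def)
  \<comment> \<open>A nonzero vertical vector of \<open>G\<close> could be scaled to height
    \<open>r + 1\<close> above the origin, where \<open>E\<close> has a point of height
    \<open>r\<close>.\<close>
  have fun0: "a = 0" if a: "(0, a) \<in> G" for a
  proof (rule ccontr)
    assume "a \<noteq> 0"
    obtain r where r: "(0, r) \<in> E" using core[of 0] by auto
    have "((r + 1) / a) *\<^sub>R (0, a) \<in> G" using G(1) a by (rule subspace_mul)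
    then have "(0, r + 1) \<in> G" using \<open>a \<noteq> 0\<close> by simp
    from Gd[OF this r] show False by simp
  qed
  have tot: "\<exists>c. (u, c) \<in> G" for u
  proof -
    \<comment> \<open>If the value at \<open>u\<close> is to be \<open>c\<close>, the extended graph
      has height \<open>a - t * c\<close> over \<open>s - t *\<^sub>R u\<close>, which must not
      exceed \<open>r\<close>: a lower bound on \<open>c\<close>. Points over
      \<open>s + t *\<^sub>R u\<close> give the upper bounds.\<close>
    define Lo where "Lo = {(a - r) / t | s t a r. t > 0 \<and> (s, a) \<in> G \<and> (s - t *\<^sub>R u, r) \<in> E}"
    \<comment> \<open>With weights \<open>t' / (t + t')\<close> and \<open>t / (t + t')\<close> the
      multiples of \<open>u\<close> cancel, so domination by \<open>E\<close> on the old
      \<open>G\<close> compares the two kinds of bounds.\<close>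
    have key: "(a - r) / t \<le> (r' - a') / t'"
      if 1: "t > 0" "(s, a) \<in> G" "(s - t *\<^sub>R u, r) \<in> E"
      and 2: "t' > 0" "(s', a') \<in> G" "(s' + t' *\<^sub>R u, r') \<in> E" for s t a r s' t' a' r'
    proof -
      have "(t' / (t + t')) *\<^sub>R (s - t *\<^sub>R u, r) + (t / (t + t')) *\<^sub>R (s' + t' *\<^sub>R u, r') \<in> E"
        using E 1 2 by (intro convexD) (auto simp: add_divide_distrib[symmetric])
      moreover have "(t' / (t + t')) *\<^sub>R (s, a) + (t / (t + t')) *\<^sub>R (s', a') \<in> G"
        using G(1) 1 2 by (intro subspace_add subspace_mul)
      ultimately have "t' / (t + t') * a + t / (t + t') * a' \<le> t' / (t + t') * r + t / (t + t') * r'"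
        by (intro Gd[of "(t' / (t + t')) *\<^sub>R s + (t / (t + t')) *\<^sub>R s'"])
          (auto simp: scaleR_add_right scaleR_diff_right algebra_simps)
      then have "(t + t') * (t' / (t + t') * a + t / (t + t') * a') \<le> (t + t') * (t' / (t + t') * r + t / (t + t') * r')"
        using 1 2 by (intro mult_left_mono) auto
      then have "t' * a + t * a' \<le> t' * r + t * r'"
        using 1(1) 2(1) by (simp add: distrib_left)
      then show ?thesis using 1(1) 2(1) by (simp add: field_simps)
    qed
    \<comment> \<open>Absorption in direction \<open>- u\<close> makes \<open>Lo\<close> nonempty;
      absorption in direction \<open>u\<close> bounds it above.\<close>
    obtain t1 r1 where 1: "t1 > 0" "(t1 *\<^sub>R u, r1) \<in> E" using core by blast
    obtain t2 r2 where 2: "t2 > 0" "(t2 *\<^sub>R (- u), r2) \<in> E" using core by blast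
    have 00: "(0, 0) \<in> G" using subspace_0[OF G(1)] by (simp add: zero_prod_def)
    have ne: "Lo \<noteq> {}" unfolding Lo_def using 2 00 by force
    have bdd: "bdd_above Lo"
      unfolding bdd_above_def Lo_def using key[OF _ _ _ 1(1) 00] 1(2) by (force simp del: divide_le_eq)
    define c where "c = Sup Lo"
    have lo: "(a - r) / t \<le> c" if "t > 0" "(s, a) \<in> G" "(s - t *\<^sub>R u, r) \<in> E" for s t a r
      unfolding c_def by (rule cSup_upper[OF _ bdd]) (use that in \<open>auto simp: Lo_def\<close>)
    have hi: "c \<le> (r - a) / t" if "t > 0" "(s, a) \<in> G" "(s + t *\<^sub>R u, r) \<in> E" for s t a r
      unfolding c_def by (rule cSup_least[OF ne]) (use that key in \<open>auto simp: Lo_def\<close>)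
    define G' where "G' = {x + y | x y. x \<in> G \<and> y \<in> span {(u, c)}}"
    have "subspace G'" unfolding G'_def by (intro subspace_sums G subspace_span)
    moreover have GG': "G \<subseteq> G'"
    proof
      fix p assume "p \<in> G"
      then have "p + 0 \<in> G'" unfolding G'_def using span_zero by blast
      then show "p \<in> G'" by simp
    qed
    moreover have "b \<le> r" if b: "(v, b) \<in> G'" "(v, r) \<in> E" for v b r
    proof -
      obtain s a k where k: "(s, a) \<in> G" "v = s + k *\<^sub>R u" "b = a + k * c"
        using b(1) by (auto simp: G'_def span_singleton)
      consider "k = 0" | "k > 0" | "k < 0" by linarith
      then show ?thesis
      proof cases
        case 1
        with k b Gd show ?thesis by auto
      next
        case 2
        with hi[of k s a r] k b show ?thesis by (auto simp: field_simps)
      next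
        case 3
        with lo[of "- k" s a r] k b show ?thesis by (auto simp: field_simps)
      qed
    qed
    ultimately have "G' \<in> \<A>" using G by (auto simp: \<A>_def)
    then have "G' = G" using max GG' by blast
    moreover have "0 + (u, c) \<in> G'"
      unfolding G'_def using subspace_0[OF G(1)] span_base[of "(u, c)"] by blast
    ultimately show ?thesis by auto
  qed
  have uniq: "a = b" if "(u, a) \<in> G" "(u, b) \<in> G" for u a b
    using fun0[of "a - b"] subspace_diff[OF G(1) that] by simp
  define L where "L u = (SOME c. (u, c) \<in> G)" for u
  have L: "(u, L u) \<in> G" for u unfolding L_def using tot by (rule someI_ex)
  have "linear L"
  proof (rule linearI)
    show "L (x + y) = L x + L y" for x y
      using uniq[OF L] subspace_add[OF G(1) L[of x] L[of y]] by simp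
    show "L (k *\<^sub>R x) = k *\<^sub>R L x" for x k
      using uniq[OF L] subspace_mul[OF G(1) L[of x], of k] by simp
  qed
  moreover have "L u = a" if "(u, a) \<in> G0" for u a using uniq[OF L] that G(2) by blast
  moreover have "L u \<le> r" if "(u, r) \<in> E" for u r using Gd[OF L that] .
  ultimately show thesis using that by blast
qed

section \<open>Forms in the algebraic dual\<close>

lemma form_add [simp]: "form (l + m) u = form l u + form m u" by transfer simp
lemma form_diff [simp]: "form (l - m) u = form l u - form m u" by transfer simp
lemma form_minus [simp]: "form (- l) u = - form l u" by transfer simp
lemma form_zero [simp]: "form 0 u = 0" by transfer simp
lemma form_scaleR [simp]: "form (c *\<^sub>R l) u = c * form l u" by transfer simp
lemma linear_form: "linear (form l)" by transfer simp
lemma form_add_right [simp]: "form l (u + v) = form l u + form l v" by (rule linear_add[OF linear_form])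
lemma form_diff_right [simp]: "form l (u - v) = form l u - form l v" by (rule linear_diff[OF linear_form])
lemma form_minus_right [simp]: "form l (- u) = - form l u" by (rule linear_neg[OF linear_form])
lemma form_zero_right [simp]: "form l 0 = 0" by (rule linear_0[OF linear_form])
lemma form_scaleR_right [simp]: "form l (c *\<^sub>R u) = c * form l u"
  using linear_scale[OF linear_form] by simp
lemma form_sum [simp]: "form (sum g A) u = (\<Sum>x\<in>A. form (g x) u)"
  by (induction A rule: infinite_finite_induct) auto

lemma form_Abs: "linear f \<Longrightarrow> form (Abs_alg_dual f) = f"
  by (simp add: Abs_alg_dual_inverse)

lemma alg_dual_eqI: "(\<And>u. form l u = form m u) \<Longrightarrow> l = m"
  by transfer auto

lemma form_separates:
  assumes "\<And>l. form l u = form l v"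
  shows "u = v"
proof (rule ccontr)
  assume "u \<noteq> v"
  then have "independent {u - v}" by simp
  from linear_independent_extend[OF this, of "\<lambda>_. 1::real"]
  obtain g :: "'a \<Rightarrow> real" where "linear g" "g (u - v) = 1" by auto
  with assms[of "Abs_alg_dual g"] show False by (simp add: form_Abs linear_diff)
qed

lemma linear_form_left: "linear (\<lambda>l. form l u)"
  by (intro linearI) auto

text \<open>Induction on the finite family: either some vector detects \<open>f j\<close> alone,
  which fixes its coefficient, or \<open>f j\<close> vanishes wherever the others do and coefficient
  0 suffices. It identifies functionals on the bidual that depend on finitely many coordinates
  only.\<close>

lemma linear_vanishing_on_kernels:
  fixes f :: "'i \<Rightarrow> 'v::real_vector \<Rightarrow> real"
  assumes "finite F" and "\<And>i. i \<in> F \<Longrightarrow> linear (f i)" and "linear \<psi>"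
    and "\<And>v. (\<forall>i\<in>F. f i v = 0) \<Longrightarrow> \<psi> v = 0"
  shows "\<exists>a. \<forall>v. \<psi> v = (\<Sum>i\<in>F. a i * f i v)"
  using assms
proof (induction F arbitrary: \<psi> rule: finite_induct)
  case empty
  then show ?case by simp
next
  case (insert j F)
  show ?case
  proof (cases "\<exists>v. (\<forall>i\<in>F. f i v = 0) \<and> f j v \<noteq> 0")
    case True
    then obtain v0 where v0: "\<forall>i\<in>F. f i v0 = 0" "f j v0 \<noteq> 0" by blast
    \<comment> \<open>The only possible coefficient of \<open>f j\<close>, because the other forms
      vanish at \<open>v0\<close>.\<close>
    define k where "k = \<psi> v0 / f j v0"
    have lj: "linear (f j)" using insert.prems by simp
    have "\<exists>a. \<forall>v. \<psi> v - k * f j v = (\<Sum>i\<in>F. a i * f i v)"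
    proof (rule insert.IH)
      show "linear (\<lambda>v. \<psi> v - k * f j v)"
        using insert.prems(2) lj by (auto simp: linear_iff algebra_simps)
      fix v assume v: "\<forall>i\<in>F. f i v = 0"
      define w where "w = v - (f j v / f j v0) *\<^sub>R v0"
      have "f i w = f i v - (f j v / f j v0) * f i v0" if "i \<in> insert j F" for i
        using insert.prems(1)[OF that] by (simp add: w_def linear_diff linear_scale)
      then have "\<forall>i\<in>insert j F. f i w = 0" using v v0 by auto
      then have "\<psi> w = 0" using insert.prems by blast
      then show "\<psi> v - k * f j v = 0"
        using insert.prems(2) by (simp add: w_def k_def linear_diff linear_scale)
    qed (use insert.prems in auto)
    then obtain a where a: "\<And>v. \<psi> v - k * f j v = (\<Sum>i\<in>F. a i * f i v)" by blast
    have "\<psi> v = (\<Sum>i\<in>insert j F. (a(j := k)) i * f i v)" for v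
    proof -
      have "(\<Sum>i\<in>F. (a(j := k)) i * f i v) = (\<Sum>i\<in>F. a i * f i v)"
        using insert.hyps by (intro sum.cong) auto
      then show ?thesis using a[of v] insert.hyps by simp
    qed
    then show ?thesis by blast
  next
    case False
    have "\<exists>a. \<forall>v. \<psi> v = (\<Sum>i\<in>F. a i * f i v)"
      by (rule insert.IH) (use insert.prems False in auto)
    then obtain a where a: "\<And>v. \<psi> v = (\<Sum>i\<in>F. a i * f i v)" by blast
    have "\<psi> v = (\<Sum>i\<in>insert j F. (a(j := 0)) i * f i v)" for v
    proof -
      have "(\<Sum>i\<in>F. (a(j := 0)) i * f i v) = (\<Sum>i\<in>F. a i * f i v)"
        using insert.hyps by (intro sum.cong) auto
      then show ?thesis using a[of v] insert.hyps by simp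
    qed
    then show ?thesis by blast
  qed
qed

text \<open>Separation in \<open>\<real>\<^sup>F\<close>, obtained by extension in the algebraic bidual.\<close>

lemma approximation_of_bounded_form:
  fixes D :: "'a::real_vector set" and F :: "'a alg_dual set"
  assumes D: "convex D" "D \<noteq> {}" and F: "finite F" and W: "linear W" and "\<epsilon> > 0"
    and bnd: "\<And>x s. x \<in> span F \<Longrightarrow> (\<And>y. y \<in> D \<Longrightarrow> form x y \<le> s) \<Longrightarrow> W x \<le> s"
  shows "\<exists>y\<in>D. \<forall>x\<in>F. \<bar>form x y - W x\<bar> < \<epsilon>"
proof (rule ccontr)
  assume far: "\<not> ?thesis"
  \<comment> \<open>Up to attainment, this is the epigraph of the distance, in the maximum norm over
    \<open>F\<close>, from \<open>\<zeta> + W\<close> to the evaluations at points of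
    \<open>D\<close>, lowered by \<epsilon>. By \<open>far\<close> that function is nonnegative at
    0.\<close>
  define E :: "('a alg_dual alg_dual \<times> real) set"
    where "E = {(\<zeta>, r). \<exists>y\<in>D. \<forall>x\<in>F. \<bar>form \<zeta> x + W x - form x y\<bar> \<le> r + \<epsilon>}"
  have "convex E"
  proof (rule convexI)
    fix p q and u v :: real
    assume pq: "p \<in> E" "q \<in> E" and uv: "0 \<le> u" "0 \<le> v" "u + v = 1"
    obtain \<zeta> r y where p: "p = (\<zeta>, r)" "y \<in> D" "\<And>x. x \<in> F \<Longrightarrow> \<bar>form \<zeta> x + W x - form x y\<bar> \<le> r + \<epsilon>"
      using pq(1) by (cases p) (auto simp: E_def)
    obtain \<zeta>' r' y' where q: "q = (\<zeta>', r')" "y' \<in> D" "\<And>x. x \<in> F \<Longrightarrow> \<bar>form \<zeta>' x + W x - form x y'\<bar> \<le> r' + \<epsilon>"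
      using pq(2) by (cases q) (auto simp: E_def)
    have "u *\<^sub>R y + v *\<^sub>R y' \<in> D" using D p q uv by (intro convexD) auto
    moreover have "\<bar>(u * form \<zeta> x + v * form \<zeta>' x) + W x - (u * form x y + v * form x y')\<bar> \<le> (u * r + v * r') + \<epsilon>"
      if "x \<in> F" for x
    proof -
      have uv': "v = 1 - u" using uv by simp
      have "(u * form \<zeta> x + v * form \<zeta>' x) + W x - (u * form x y + v * form x y')
          = u * (form \<zeta> x + W x - form x y) + v * (form \<zeta>' x + W x - form x y')"
        unfolding uv' by (simp add: algebra_simps)
      also have "\<bar>\<dots>\<bar> \<le> u * \<bar>form \<zeta> x + W x - form x y\<bar> + v * \<bar>form \<zeta>' x + W x - form x y'\<bar>"
        using uv by (intro order_trans[OF abs_triangle_ineq]) (auto simp: abs_mult)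
      also have "\<dots> \<le> u * (r + \<epsilon>) + v * (r' + \<epsilon>)"
        using uv that p q by (intro add_mono mult_left_mono) auto
      also have "\<dots> = (u * r + v * r') + \<epsilon>" unfolding uv' by (simp add: algebra_simps)
      finally show ?thesis .
    qed
    ultimately show "u *\<^sub>R p + v *\<^sub>R q \<in> E"
      unfolding p(1) q(1) E_def by (auto intro!: bexI[of _ "u *\<^sub>R y + v *\<^sub>R y'"])
  qed
  moreover have "a \<le> r" if \<zeta>: "(\<zeta>, a) \<in> {0}" "(\<zeta>, r) \<in> E" for \<zeta> a r
  proof -
    have "\<zeta> = 0" "a = 0" using \<zeta>(1) by (auto simp: zero_prod_def)
    then obtain y where y: "y \<in> D" "\<And>x. x \<in> F \<Longrightarrow> \<bar>W x - form x y\<bar> \<le> r + \<epsilon>"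
      using \<zeta>(2) by (auto simp: E_def)
    obtain x where "x \<in> F" "\<bar>form x y - W x\<bar> \<ge> \<epsilon>" using far y(1) by force
    with y(2)[of x] \<open>a = 0\<close> show ?thesis by linarith
  qed
  \<comment> \<open>One height serves two purposes: \<open>t = 1\<close> makes \<open>E\<close>
    absorbing, and a form vanishing on \<open>F\<close> has its whole line in \<open>E\<close> at
    that height, which forces \<psi> to vanish there.\<close>
  moreover have E_large: "\<exists>r. \<forall>t. \<bar>t\<bar> = 1 \<or> (\<forall>x\<in>F. form \<zeta> x = 0) \<longrightarrow> (t *\<^sub>R \<zeta>, r) \<in> E" for \<zeta>
  proof -
    obtain y where y: "y \<in> D" using D(2) by blast
    have "\<bar>t * form \<zeta> x + W x - form x y\<bar> \<le> (\<Sum>x\<in>F. \<bar>form \<zeta> x\<bar> + \<bar>W x - form x y\<bar>)"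
      if "\<bar>t\<bar> = 1 \<or> (\<forall>x\<in>F. form \<zeta> x = 0)" "x \<in> F" for t x
    proof -
      have "\<bar>t * form \<zeta> x\<bar> \<le> \<bar>form \<zeta> x\<bar>" using that by (auto simp: abs_mult)
      then have "\<bar>t * form \<zeta> x + W x - form x y\<bar> \<le> \<bar>form \<zeta> x\<bar> + \<bar>W x - form x y\<bar>" by linarith
      also have "\<dots> \<le> (\<Sum>x\<in>F. \<bar>form \<zeta> x\<bar> + \<bar>W x - form x y\<bar>)"
        by (rule member_le_sum[OF that(2)]) (use F in auto)
      finally show ?thesis .
    qed
    then show ?thesis using y unfolding E_def form_scaleR mem_Collect_eq case_prod_conv
      by (intro exI[of _ "(\<Sum>x\<in>F. \<bar>form \<zeta> x\<bar> + \<bar>W x - form x y\<bar>) - \<epsilon>"] allI impI bexI[of _ y]) auto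
  qed
  moreover have "\<exists>t>0. \<exists>r. (t *\<^sub>R \<zeta>, r) \<in> E" for \<zeta>
    using E_large[of \<zeta>] by (metis abs_one zero_less_one)
  ultimately obtain \<psi> where \<psi>: "linear \<psi>" "\<And>\<zeta> r. (\<zeta>, r) \<in> E \<Longrightarrow> \<psi> \<zeta> \<le> r"
    using convex_domination_extension[of E "{0}"] subspace_single_0 by metis
  have "\<psi> \<zeta> = 0" if z: "\<forall>x\<in>F. form \<zeta> x = 0" for \<zeta>
  proof (rule ccontr)
    assume ne: "\<psi> \<zeta> \<noteq> 0"
    obtain r where r: "\<And>t. (t *\<^sub>R \<zeta>, r) \<in> E" using E_large[of \<zeta>] z by auto
    have "\<psi> (((r + 1) / \<psi> \<zeta>) *\<^sub>R \<zeta>) \<le> r" by (rule \<psi>(2)[OF r])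
    then show False using ne \<psi>(1) by (simp add: linear_scale)
  qed
  then obtain a where a: "\<And>\<zeta>. \<psi> \<zeta> = (\<Sum>x\<in>F. a x * form \<zeta> x)"
    using linear_vanishing_on_kernels[OF F, of "\<lambda>x \<zeta>. form \<zeta> x" \<psi>] \<psi>(1) linear_form_left by blast
  define x where "x = (\<Sum>x\<in>F. a x *\<^sub>R x)"
  have \<psi>x: "\<psi> \<zeta> = form \<zeta> x" for \<zeta>
    by (simp add: a x_def linear_sum[OF linear_form])
  have "form x y \<le> W x - \<epsilon>" if y: "y \<in> D" for y
  proof -
    \<comment> \<open>Evaluation at \<open>y\<close> minus \<open>W\<close> has distance zero, hence
      lies in \<open>E\<close> at height \<open>- \<epsilon>\<close>. This yields a gap of
      \<epsilon> between \<open>form x\<close> on \<open>D\<close> and \<open>W x\<close>,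
      contradicting \<open>bnd\<close>.\<close>
    define \<zeta> where "\<zeta> = Abs_alg_dual (\<lambda>x. form x y) - Abs_alg_dual W"
    have \<zeta>: "form \<zeta> x = form x y - W x" for x
      by (simp add: \<zeta>_def form_Abs linear_form_left W)
    have "(\<zeta>, - \<epsilon>) \<in> E" using y by (auto simp: E_def \<zeta>)
    from \<psi>(2)[OF this] show ?thesis by (simp add: \<psi>x \<zeta>)
  qed
  moreover have "x \<in> span F" unfolding x_def by (intro span_sum span_scale span_base)
  ultimately have "W x \<le> W x - \<epsilon>" by (intro bnd)
  with \<open>\<epsilon> > 0\<close> show False by simp
qed

section \<open>Luxemburg norm, its dual, and the convex conjugate\<close>

context
  fixes F :: "'a::real_vector \<Rightarrow> ereal"
  assumes F: "H_Phi F"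
begin

lemma H_Phi_nonneg: "0 \<le> F u"
  and H_Phi_zero: "F 0 = 0"
  using F by (auto simp: H_Phi_def)

text \<open>Convexity restated with real upper bounds, the shape in which every later epigraph is
  shown to be convex.\<close>

lemma H_Phi_convex:
  assumes "F u \<le> ereal r" "F v \<le> ereal s" "0 \<le> a" "0 \<le> b" "a + b = 1"
  shows "F (a *\<^sub>R u + b *\<^sub>R v) \<le> ereal (a * r + b * s)"
proof -
  have "F ((1 - b) *\<^sub>R u + b *\<^sub>R v) \<le> ereal (1 - b) * F u + ereal b * F v"
    using F assms unfolding H_Phi_def by auto
  also have "\<dots> \<le> ereal (1 - b) * ereal r + ereal b * ereal s"
    using assms by (intro add_mono ereal_mult_left_mono) auto
  also have "1 - b = a" using assms by simp
  finally show ?thesis by simp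
qed

lemma H_Phi_scale:
  assumes "F u \<le> ereal r" "0 \<le> t" "t \<le> 1"
  shows "F (t *\<^sub>R u) \<le> ereal (t * r)"
  using H_Phi_convex[OF assms(1), of 0 0 t "1 - t"] assms H_Phi_zero by simp

lemma H_Phi_absorbing: "\<exists>\<alpha>>0. F (\<alpha> *\<^sub>R u) \<le> 1 \<and> F (- (\<alpha> *\<^sub>R u)) \<le> 1"
proof -
  \<comment> \<open>A whole interval of admissible scalings is needed so that the minimum can serve
    both \<open>u\<close> and \<open>- u\<close>.\<close>
  have one: "\<exists>\<alpha>>0. \<forall>\<beta>. 0 \<le> \<beta> \<and> \<beta> \<le> \<alpha> \<longrightarrow> F (\<beta> *\<^sub>R v) \<le> 1" for v
  proof -
    obtain \<alpha> where \<alpha>: "\<alpha> > 0" "F (\<alpha> *\<^sub>R v) < \<infinity>"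
      using F unfolding H_Phi_def by blast
    then obtain r where r: "F (\<alpha> *\<^sub>R v) = ereal r" "0 \<le> r"
      using H_Phi_nonneg[of "\<alpha> *\<^sub>R v"] by (cases "F (\<alpha> *\<^sub>R v)") auto
    \<comment> \<open>Convexity and \<open>F 0 = 0\<close> give the bound
      \<open>r / (1 + r)\<close>; the denominator \<open>1 + r\<close> also covers
      \<open>r = 0\<close>.\<close>
    have "F (\<beta> *\<^sub>R v) \<le> 1" if \<beta>: "0 \<le> \<beta>" "\<beta> \<le> \<alpha> / (1 + r)" for \<beta>
    proof -
      have \<beta>': "\<beta> / \<alpha> \<le> 1 / (1 + r)" using \<beta> \<alpha> by (simp add: field_simps)
      also have "\<dots> \<le> 1" using r by simp
      finally have "F ((\<beta> / \<alpha>) *\<^sub>R (\<alpha> *\<^sub>R v)) \<le> ereal (\<beta> / \<alpha> * r)"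
        using \<alpha> \<beta> r by (intro H_Phi_scale) auto
      also have "\<beta> / \<alpha> * r \<le> 1 / (1 + r) * r" using r \<beta>' by (intro mult_right_mono) auto
      also have "\<dots> \<le> 1" using r by simp
      finally show ?thesis using \<alpha> by (simp add: one_ereal_def)
    qed
    then show ?thesis using \<alpha> r by (intro exI[of _ "\<alpha> / (1 + r)"]) auto
  qed
  obtain \<alpha> where \<alpha>: "\<alpha> > 0" "\<And>\<beta>. 0 \<le> \<beta> \<Longrightarrow> \<beta> \<le> \<alpha> \<Longrightarrow> F (\<beta> *\<^sub>R u) \<le> 1"
    using one[of u] by blast
  obtain \<alpha>' where \<alpha>': "\<alpha>' > 0" "\<And>\<beta>. 0 \<le> \<beta> \<Longrightarrow> \<beta> \<le> \<alpha>' \<Longrightarrow> F (\<beta> *\<^sub>R - u) \<le> 1"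
    using one[of "- u"] by blast
  show ?thesis using \<alpha>(1) \<alpha>'(1) \<alpha>(2)[of "min \<alpha> \<alpha>'"] \<alpha>'(2)[of "min \<alpha> \<alpha>'"]
    by (intro exI[of _ "min \<alpha> \<alpha>'"]) auto
qed

lemma lux_norm_le:
  assumes "\<alpha> > 0" "F (u /\<^sub>R \<alpha>) \<le> 1" "F (- (u /\<^sub>R \<alpha>)) \<le> 1"
  shows "lux_norm F u \<le> \<alpha>"
  unfolding lux_norm_def by (rule cInf_lower) (use assms in \<open>auto intro!: bdd_belowI[of _ 0]\<close>)

text \<open>Some admissible \<beta> lies below \<alpha>, and convexity with \<open>F 0 = 0\<close>
  carries the unit bound from \<beta> to any larger scale.\<close>

lemma lux_norm_lessD:
  assumes "lux_norm F u < \<alpha>"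
  shows "\<alpha> > 0" "F (u /\<^sub>R \<alpha>) \<le> 1" "F (- (u /\<^sub>R \<alpha>)) \<le> 1"
proof -
  obtain \<gamma> where "\<gamma> > 0" "F (\<gamma> *\<^sub>R u) \<le> 1" "F (- (\<gamma> *\<^sub>R u)) \<le> 1" using H_Phi_absorbing by blast
  then have "inverse \<gamma> \<in> {\<alpha>::real. \<alpha> > 0 \<and> max (F (u /\<^sub>R \<alpha>)) (F (- (u /\<^sub>R \<alpha>))) \<le> 1}" by auto
  then have "{\<alpha>::real. \<alpha> > 0 \<and> max (F (u /\<^sub>R \<alpha>)) (F (- (u /\<^sub>R \<alpha>))) \<le> 1} \<noteq> {}" by blast
  from cInf_lessD[OF this assms[unfolded lux_norm_def]]
  obtain \<beta> where \<beta>: "\<beta> > 0" "F (u /\<^sub>R \<beta>) \<le> 1" "F (- (u /\<^sub>R \<beta>)) \<le> 1" "\<beta> < \<alpha>" by auto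
  show \<alpha>: "\<alpha> > 0" using \<beta> by simp
  have *: "F ((\<beta> / \<alpha>) *\<^sub>R v) \<le> 1" if "F v \<le> 1" for v
  proof -
    have "F ((\<beta> / \<alpha>) *\<^sub>R v) \<le> ereal (\<beta> / \<alpha> * 1)"
      using that \<beta> \<alpha> by (intro H_Phi_scale) (auto simp: one_ereal_def)
    also have "\<dots> \<le> 1" using \<beta> \<alpha> by (simp add: one_ereal_def)
    finally show ?thesis .
  qed
  show "F (u /\<^sub>R \<alpha>) \<le> 1" "F (- (u /\<^sub>R \<alpha>)) \<le> 1"
  proof -
    have "\<beta> / \<alpha> * inverse \<beta> = inverse \<alpha>" using \<beta>(1) by (simp add: divide_inverse)
    then show "F (u /\<^sub>R \<alpha>) \<le> 1" "F (- (u /\<^sub>R \<alpha>)) \<le> 1"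
      using *[OF \<beta>(2)] *[OF \<beta>(3)] by (simp_all only: scaleR_scaleR scaleR_minus_right)
  qed
qed

lemma lux_norm_nonneg: "0 \<le> lux_norm F u"
  using lux_norm_lessD(1)[of u] by (meson less_irrefl not_le)

lemma lux_norm_minus: "lux_norm F (- u) = lux_norm F u"
  by (simp add: lux_norm_def max.commute)

lemma lux_norm_triangle: "lux_norm F (u + v) \<le> lux_norm F u + lux_norm F v"
proof (rule field_le_epsilon)
  fix e :: real assume e: "e > 0"
  define \<alpha> \<beta> where "\<alpha> = lux_norm F u + e / 2" and "\<beta> = lux_norm F v + e / 2"
  have \<alpha>: "\<alpha> > 0" "F (u /\<^sub>R \<alpha>) \<le> 1" "F (- (u /\<^sub>R \<alpha>)) \<le> 1"
    using e by (intro lux_norm_lessD[of u]; simp add: \<alpha>_def)+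
  have \<beta>: "\<beta> > 0" "F (v /\<^sub>R \<beta>) \<le> 1" "F (- (v /\<^sub>R \<beta>)) \<le> 1"
    using e by (intro lux_norm_lessD[of v]; simp add: \<beta>_def)+
  have conv: "F ((\<alpha> / (\<alpha> + \<beta>)) *\<^sub>R x + (\<beta> / (\<alpha> + \<beta>)) *\<^sub>R y) \<le> 1" if "F x \<le> 1" "F y \<le> 1" for x y
    using H_Phi_convex[of x 1 y 1 "\<alpha> / (\<alpha> + \<beta>)" "\<beta> / (\<alpha> + \<beta>)"] that \<alpha> \<beta>
    by (simp add: add_divide_distrib[symmetric] one_ereal_def)
  have eq: "(u + v) /\<^sub>R (\<alpha> + \<beta>) = (\<alpha> / (\<alpha> + \<beta>)) *\<^sub>R (u /\<^sub>R \<alpha>) + (\<beta> / (\<alpha> + \<beta>)) *\<^sub>R (v /\<^sub>R \<beta>)"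
  proof -
    have "\<alpha> / (\<alpha> + \<beta>) * inverse \<alpha> = inverse (\<alpha> + \<beta>)" "\<beta> / (\<alpha> + \<beta>) * inverse \<beta> = inverse (\<alpha> + \<beta>)"
      using \<alpha>(1) \<beta>(1) by (auto simp: divide_inverse)
    then show ?thesis by (simp only: scaleR_scaleR scaleR_add_right)
  qed
  have "lux_norm F (u + v) \<le> \<alpha> + \<beta>"
  proof (rule lux_norm_le)
    show "F ((u + v) /\<^sub>R (\<alpha> + \<beta>)) \<le> 1" unfolding eq using \<alpha> \<beta> by (intro conv)
    have eq': "- ((u + v) /\<^sub>R (\<alpha> + \<beta>)) = (\<alpha> / (\<alpha> + \<beta>)) *\<^sub>R - (u /\<^sub>R \<alpha>) + (\<beta> / (\<alpha> + \<beta>)) *\<^sub>R - (v /\<^sub>R \<beta>)"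
      unfolding eq by simp
    show "F (- ((u + v) /\<^sub>R (\<alpha> + \<beta>))) \<le> 1" unfolding eq' using \<alpha> \<beta> by (intro conv)
  qed (use \<alpha> \<beta> in simp)
  then show "lux_norm F (u + v) \<le> lux_norm F u + lux_norm F v + e" by (simp add: \<alpha>_def \<beta>_def)
qed

lemma lux_norm_eq_0: "lux_norm F u = 0 \<longleftrightarrow> u = 0"
proof
  assume 0: "lux_norm F u = 0"
  show "u = 0"
  proof (rule ccontr)
    assume "u \<noteq> 0"
    then obtain t where t: "F (t *\<^sub>R u) > 0" using F by (auto simp: H_Phi_def)
    have bnd: "F (s *\<^sub>R u) \<le> 1" for s
    proof -
      consider "s = 0" | "s > 0" | "s < 0" by linarith
      then show ?thesis
      proof cases
        case 1 then show ?thesis by (simp add: H_Phi_zero)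
      next
        case 2 then show ?thesis using lux_norm_lessD(2)[of u "inverse s"] 0 by simp
      next
        case 3 then show ?thesis using lux_norm_lessD(3)[of u "inverse (- s)"] 0 by simp
      qed
    qed
    obtain c where c: "F (t *\<^sub>R u) = ereal c" "0 < c" "c \<le> 1"
      using t bnd[of t] by (cases "F (t *\<^sub>R u)") (auto simp: one_ereal_def)
    \<comment> \<open>\<open>F\<close> is at most 1 along the whole line, so contracting the far
      point by \<open>c / 2\<close> gives \<open>F (t *\<^sub>R u) \<le> c / 2\<close>, although the
      value is \<open>c\<close>.\<close>
    have "F ((c / 2) *\<^sub>R ((t * 2 / c) *\<^sub>R u)) \<le> ereal (c / 2 * 1)"
      using c bnd by (intro H_Phi_scale) (auto simp: one_ereal_def)
    then show False using c by simp
  qed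
next
  assume "u = 0"
  have "lux_norm F 0 \<le> e" if "e > 0" for e
    using that by (intro lux_norm_le) (auto simp: H_Phi_zero)
  then have "lux_norm F 0 \<le> 0" by (meson dense_ge)
  then show "lux_norm F u = 0" using lux_norm_nonneg[of 0] \<open>u = 0\<close> by simp
qed

lemma Metric_space_lux_dist: "Metric_space UNIV (lux_dist F)"
proof
  fix x y z
  show "0 \<le> lux_dist F x y" by (simp add: lux_dist_def lux_norm_nonneg)
  show "lux_dist F x y = lux_dist F y x"
    unfolding lux_dist_def using lux_norm_minus[of "x - y"] by simp
  show "lux_dist F x y = 0 \<longleftrightarrow> x = y" by (simp add: lux_dist_def lux_norm_eq_0)
  show "lux_dist F x z \<le> lux_dist F x y + lux_dist F y z"
    unfolding lux_dist_def using lux_norm_triangle[of "x - y" "y - z"] by simp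
qed

lemma form_le_lux_norm:
  assumes K: "\<And>v. F v \<le> 1 \<Longrightarrow> F (- v) \<le> 1 \<Longrightarrow> \<bar>form l v\<bar> \<le> K"
  shows "\<bar>form l u\<bar> \<le> K * lux_norm F u"
proof -
  have K0: "0 \<le> K" using K[of 0] H_Phi_zero by simp
  have *: "\<bar>form l u\<bar> \<le> K * \<alpha>" if "lux_norm F u < \<alpha>" for \<alpha>
  proof -
    note \<alpha> = lux_norm_lessD[OF that]
    have "\<bar>form l (u /\<^sub>R \<alpha>)\<bar> \<le> K" using \<alpha> by (intro K)
    then show ?thesis using \<alpha>(1) by (simp add: abs_mult field_simps)
  qed
  show ?thesis
  proof (rule field_le_epsilon)
    fix e :: real assume e: "e > 0"
    \<comment> \<open>Dividing by \<open>K + 1\<close> rather than \<open>K\<close> covers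
      \<open>K = 0\<close>.\<close>
    have "\<bar>form l u\<bar> \<le> K * (lux_norm F u + e / (K + 1))" using e K0 by (intro *) auto
    also have "\<dots> = K * lux_norm F u + e * (K / (K + 1))" by (simp add: algebra_simps)
    also have "\<dots> \<le> K * lux_norm F u + e"
      using e K0 by (intro add_left_mono mult_left_le) (auto simp: field_simps)
    finally show "\<bar>form l u\<bar> \<le> K * lux_norm F u + e" .
  qed
qed

text \<open>The norm behaves linearly under scaling, so continuity at the origin already bounds the
  form on the unit ball, and such a bound makes it Lipschitz. This replaces the topological
  definition by an inequality.\<close>

lemma top_dual_iff:
  "l \<in> top_dual F \<longleftrightarrow> (\<exists>K. \<forall>u. F u \<le> 1 \<longrightarrow> F (- u) \<le> 1 \<longrightarrow> \<bar>form l u\<bar> \<le> K)"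
proof -
  interpret Metric_space UNIV "lux_dist F" by (rule Metric_space_lux_dist)
  have "l \<in> top_dual F \<longleftrightarrow> (\<forall>U. open U \<longrightarrow> (\<forall>x. form l x \<in> U \<longrightarrow> (\<exists>r>0. \<forall>y. lux_dist F x y < r \<longrightarrow> form l y \<in> U)))"
    unfolding top_dual_def by (auto simp: continuous_map_def openin_mtopology mball_def subset_iff)
  also have "\<dots> \<longleftrightarrow> (\<exists>K. \<forall>u. F u \<le> 1 \<longrightarrow> F (- u) \<le> 1 \<longrightarrow> \<bar>form l u\<bar> \<le> K)"
  proof
    assume *: "\<forall>U. open U \<longrightarrow> (\<forall>x. form l x \<in> U \<longrightarrow> (\<exists>r>0. \<forall>y. lux_dist F x y < r \<longrightarrow> form l y \<in> U))"
    have "open {-1<..<1::real}" "form l 0 \<in> {-1<..<1}" by auto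
    with * obtain r where r: "r > 0" "\<And>y. lux_dist F 0 y < r \<Longrightarrow> form l y \<in> {-1<..<1}" by meson
    have "\<bar>form l u\<bar> \<le> 2 / r" if "F u \<le> 1" "F (- u) \<le> 1" for u
    proof -
      have "lux_norm F ((r / 2) *\<^sub>R u) \<le> r / 2" using r that by (intro lux_norm_le) auto
      then have "lux_dist F 0 ((r / 2) *\<^sub>R u) < r"
        using r(1) lux_norm_minus[of "(r / 2) *\<^sub>R u"] by (simp add: lux_dist_def)
      from r(2)[OF this] have "\<bar>r / 2 * form l u\<bar> < 1" by auto
      then show ?thesis using r(1) by (simp add: abs_mult field_simps)
    qed
    then show "\<exists>K. \<forall>u. F u \<le> 1 \<longrightarrow> F (- u) \<le> 1 \<longrightarrow> \<bar>form l u\<bar> \<le> K" by blast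
  next
    assume "\<exists>K. \<forall>u. F u \<le> 1 \<longrightarrow> F (- u) \<le> 1 \<longrightarrow> \<bar>form l u\<bar> \<le> K"
    then obtain K where K: "\<And>u. F u \<le> 1 \<Longrightarrow> F (- u) \<le> 1 \<Longrightarrow> \<bar>form l u\<bar> \<le> K" by blast
    have K0: "0 \<le> K" using K[of 0] H_Phi_zero by simp
    show "\<forall>U. open U \<longrightarrow> (\<forall>x. form l x \<in> U \<longrightarrow> (\<exists>r>0. \<forall>y. lux_dist F x y < r \<longrightarrow> form l y \<in> U))"
    proof (intro allI impI)
      fix U :: "real set" and x assume U: "open U" "form l x \<in> U"
      then obtain e where e: "e > 0" "\<And>a. \<bar>a - form l x\<bar> < e \<Longrightarrow> a \<in> U"
        unfolding open_dist dist_real_def by blast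
      have "form l y \<in> U" if y: "lux_dist F x y < e / (K + 1)" for y
      proof (rule e(2))
        have "\<bar>form l (x - y)\<bar> \<le> K * lux_norm F (x - y)" by (rule form_le_lux_norm[OF K])
        also have "\<dots> \<le> K * (e / (K + 1))"
          using y K0 by (intro mult_left_mono) (auto simp: lux_dist_def)
        also have "\<dots> < e" using e(1) K0 by (simp add: field_simps)
        finally show "\<bar>form l y - form l x\<bar> < e" by simp
      qed
      then show "\<exists>r>0. \<forall>y. lux_dist F x y < r \<longrightarrow> form l y \<in> U"
        using e(1) K0 by (intro exI[of _ "e / (K + 1)"]) auto
    qed
  qed
  finally show ?thesis .
qed

lemma subspace_top_dual: "subspace (top_dual F)"
proof (rule subspaceI)
  show "0 \<in> top_dual F" unfolding top_dual_iff by auto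
  show "l + m \<in> top_dual F" if lm: "l \<in> top_dual F" "m \<in> top_dual F" for l m
  proof -
    obtain K M where K: "\<And>u. F u \<le> 1 \<Longrightarrow> F (- u) \<le> 1 \<Longrightarrow> \<bar>form l u\<bar> \<le> K"
      and M: "\<And>u. F u \<le> 1 \<Longrightarrow> F (- u) \<le> 1 \<Longrightarrow> \<bar>form m u\<bar> \<le> M"
      using lm unfolding top_dual_iff by blast
    have "\<bar>form (l + m) u\<bar> \<le> K + M" if "F u \<le> 1" "F (- u) \<le> 1" for u
      using K[OF that] M[OF that] by simp
    then show ?thesis unfolding top_dual_iff by blast
  qed
  show "c *\<^sub>R l \<in> top_dual F" if l: "l \<in> top_dual F" for c l
  proof -
    obtain K where K: "\<And>u. F u \<le> 1 \<Longrightarrow> F (- u) \<le> 1 \<Longrightarrow> \<bar>form l u\<bar> \<le> K"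
      using l unfolding top_dual_iff by blast
    have "\<bar>form (c *\<^sub>R l) u\<bar> \<le> \<bar>c\<bar> * K" if "F u \<le> 1" "F (- u) \<le> 1" for u
      using K[OF that] by (simp add: abs_mult mult_left_mono)
    then show ?thesis unfolding top_dual_iff by blast
  qed
qed

text \<open>Since \<open>F\<close> never takes the value -\<infinity>, it can be moved across the
  inequality. A sublevel set is thereby cut out by one closed condition per point \<open>u\<close>,
  the form needed for compactness.\<close>

lemma Phi_conj_le_iff: "Phi_conj F l \<le> ereal r \<longleftrightarrow> (\<forall>u. ereal (form l u) \<le> F u + ereal r)"
proof -
  have "ereal a - F u \<le> ereal r \<longleftrightarrow> ereal a \<le> F u + ereal r" for a u
    using H_Phi_nonneg[of u] by (cases "F u") auto
  then show ?thesis unfolding Phi_conj_def fenchel_conj_def SUP_le_iff by simp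
qed

lemma Phi_conj_leD: "Phi_conj F l \<le> ereal r \<Longrightarrow> F u \<le> ereal s \<Longrightarrow> form l u \<le> s + r"
  unfolding Phi_conj_le_iff
  by (metis add_right_mono ereal_less_eq(3) order_trans plus_ereal.simps(1))

lemma Phi_conj_nonneg: "0 \<le> Phi_conj F l"
  unfolding Phi_conj_def fenchel_conj_def by (rule SUP_upper2[of 0]) (auto simp: H_Phi_zero)

lemma Phi_conj_zero: "Phi_conj F 0 = 0"
  using Phi_conj_le_iff[of 0 0] Phi_conj_nonneg[of 0] H_Phi_nonneg
  by (simp add: zero_ereal_def[symmetric] order_antisym)

lemma Phi_conj_lessD:
  assumes "Phi_conj F l < \<infinity>"
  obtains r where "Phi_conj F l = ereal r" "0 \<le> r"
  using assms Phi_conj_nonneg[of l] by (cases "Phi_conj F l") auto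

lemma Phi_conj_convex:
  assumes "Phi_conj F l \<le> ereal r" "Phi_conj F m \<le> ereal s" "0 \<le> a" "0 \<le> b" "a + b = 1"
  shows "Phi_conj F (a *\<^sub>R l + b *\<^sub>R m) \<le> ereal (a * r + b * s)"
  unfolding Phi_conj_le_iff
proof
  fix u
  show "ereal (form (a *\<^sub>R l + b *\<^sub>R m) u) \<le> F u + ereal (a * r + b * s)"
  proof (cases "F u")
    case (real t)
    have "a * form l u + b * form m u \<le> a * (t + r) + b * (t + s)"
      using assms real by (intro add_mono mult_left_mono Phi_conj_leD) auto
    also have "\<dots> = (a + b) * t + (a * r + b * s)" by (simp add: algebra_simps)
    finally show ?thesis using real assms by simp
  qed (use H_Phi_nonneg[of u] in auto)
qed

text \<open>Young's inequality at \<open>u\<close> and at \<open>- u\<close>. Sublevel sets of the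
  conjugate are thus norm bounded, and finiteness of the conjugate forces norm continuity.\<close>

lemma Phi_conj_le_ball:
  assumes "Phi_conj F l \<le> ereal r" "F u \<le> 1" "F (- u) \<le> 1"
  shows "\<bar>form l u\<bar> \<le> 1 + r"
  using Phi_conj_leD[OF assms(1), of u 1] Phi_conj_leD[OF assms(1), of "- u" 1] assms(2,3)
  by (simp add: one_ereal_def abs_le_iff)

lemma Phi_conj_top_dual: "Phi_conj F l < \<infinity> \<Longrightarrow> l \<in> top_dual F"
  by (metis Phi_conj_lessD Phi_conj_le_ball order_refl top_dual_iff)

lemma Phi_conj_le_top_dual: "Phi_conj F l \<le> ereal r \<Longrightarrow> l \<in> top_dual F"
  by (rule Phi_conj_top_dual) auto

text \<open>A form bounded by \<open>1 + max (F u) (F (-u))\<close> on the diagonal extends to the product under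
  \<open>1 + max (F u) (F (-v))\<close>, and the two components of the extension have finite conjugates.\<close>

lemma top_dual_span: "top_dual F \<subseteq> span {l. Phi_conj F l < \<infinity>}"
proof
  fix l assume "l \<in> top_dual F"
  then obtain K0 where K0: "\<And>u. F u \<le> 1 \<Longrightarrow> F (- u) \<le> 1 \<Longrightarrow> \<bar>form l u\<bar> \<le> K0"
    unfolding top_dual_iff by blast
  define K where "K = max K0 1"
  have K: "K > 0" "\<And>u. F u \<le> 1 \<Longrightarrow> F (- u) \<le> 1 \<Longrightarrow> \<bar>form l u\<bar> \<le> K"
    using K0 by (auto simp: K_def intro: le_max_iff_disj[THEN iffD2])
  define m where "m = l /\<^sub>R K"
  have m1: "\<bar>form m u\<bar> \<le> 1" if "F u \<le> 1" "F (- u) \<le> 1" for u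
    using K(2)[OF that] K(1) by (simp add: m_def abs_mult field_simps)
  \<comment> \<open>The bound on the unit ball spreads to the whole space by convexity: for
    \<open>r > 1\<close> the vector is divided by \<open>r\<close> to return to the ball.\<close>
  have m: "form m u \<le> 1 + r" if r: "F u \<le> ereal r" "F (- u) \<le> ereal r" for u r
  proof (cases "r \<le> 1")
    case True
    have "\<bar>form m u\<bar> \<le> 1"
      using r True by (intro m1) (auto simp: one_ereal_def intro: order_trans)
    moreover have "0 \<le> r" using r(1) H_Phi_nonneg[of u] by (metis ereal_less_eq(5) order_trans)
    ultimately show ?thesis by linarith
  next
    case False
    have "F ((1 / r) *\<^sub>R u) \<le> ereal (1 / r * r)" "F ((1 / r) *\<^sub>R - u) \<le> ereal (1 / r * r)"
      using False r by (intro H_Phi_scale; simp)+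
    then have "\<bar>form m ((1 / r) *\<^sub>R u)\<bar> \<le> 1" using False by (intro m1) (auto simp: one_ereal_def)
    then show ?thesis using False by (simp add: abs_mult field_simps)
  qed
  define E :: "(('a \<times> 'a) \<times> real) set"
    where "E = {(p, r). F (fst p) \<le> ereal (r - 1) \<and> F (- snd p) \<le> ereal (r - 1)}"
  define G where "G = range (\<lambda>u. ((u, u), form m u))"
  have "convex E"
  proof (rule convexI)
    fix x y and a b :: real
    assume xy: "x \<in> E" "y \<in> E" and ab: "0 \<le> a" "0 \<le> b" "a + b = 1"
    obtain u v r u' v' r' where eq: "x = ((u, v), r)" "y = ((u', v'), r')"
      by (metis prod.exhaust)
    have e: "a * (r - 1) + b * (r' - 1) = (a * r + b * r') - 1"
      using ab(3) by (simp add: algebra_simps)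
    have "F (a *\<^sub>R u + b *\<^sub>R u') \<le> ereal (a * (r - 1) + b * (r' - 1))"
      "F (a *\<^sub>R - v + b *\<^sub>R - v') \<le> ereal (a * (r - 1) + b * (r' - 1))"
      using xy eq ab by (intro H_Phi_convex; simp add: E_def)+
    then show "a *\<^sub>R x + b *\<^sub>R y \<in> E" unfolding e by (simp add: E_def eq algebra_simps)
  qed
  moreover have "subspace G"
  proof -
    have "linear (\<lambda>u. ((u, u), form m u))" by (auto simp: linear_iff)
    then show ?thesis unfolding G_def by (intro linear_subspace_image subspace_UNIV)
  qed
  moreover have "a \<le> r" if "(p, a) \<in> G" "(p, r) \<in> E" for p a r
    using that m[of _ "r - 1"] by (auto simp: G_def E_def)
  moreover have "\<exists>t>0. \<exists>r. (t *\<^sub>R p, r) \<in> E" for p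
  proof -
    obtain \<alpha> where \<alpha>: "\<alpha> > 0" "F (\<alpha> *\<^sub>R fst p) \<le> 1" using H_Phi_absorbing by blast
    obtain \<beta> where \<beta>: "\<beta> > 0" "F (- (\<beta> *\<^sub>R snd p)) \<le> 1" using H_Phi_absorbing by blast
    define t where "t = min \<alpha> \<beta>"
    have "F ((t / \<alpha>) *\<^sub>R (\<alpha> *\<^sub>R fst p)) \<le> ereal (t / \<alpha> * 1)"
      using \<alpha> \<beta> by (intro H_Phi_scale) (auto simp: t_def one_ereal_def)
    also have "\<dots> \<le> ereal 1" using \<alpha> \<beta> by (simp add: t_def)
    finally have 1: "F (t *\<^sub>R fst p) \<le> 1" using \<alpha> by (simp add: one_ereal_def)
    have "F ((t / \<beta>) *\<^sub>R - (\<beta> *\<^sub>R snd p)) \<le> ereal (t / \<beta> * 1)"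
      using \<alpha> \<beta> by (intro H_Phi_scale) (auto simp: t_def one_ereal_def)
    also have "\<dots> \<le> ereal 1" using \<alpha> \<beta> by (simp add: t_def)
    finally have 2: "F (- (t *\<^sub>R snd p)) \<le> 1" using \<beta> by (simp add: one_ereal_def)
    show ?thesis using 1 2 \<alpha> \<beta>
      by (intro exI[of _ t] conjI exI[of _ 2]) (auto simp: t_def E_def one_ereal_def)
  qed
  ultimately obtain L where L: "linear L" "\<And>p a. (p, a) \<in> G \<Longrightarrow> L p = a" "\<And>p r. (p, r) \<in> E \<Longrightarrow> L p \<le> r"
    using convex_domination_extension[of E G] by metis
  \<comment> \<open>The second component is negated so that \<open>m\<close> becomes a difference.
    With \<open>- snd p\<close> in \<open>E\<close>, the estimate at \<open>(0, - u)\<close> then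
    bounds \<open>form l2 u\<close> by \<open>F u + 1\<close>, with \<open>F u\<close> and not
    \<open>F (- u)\<close>.\<close>
  define l1 l2 where "l1 = Abs_alg_dual (\<lambda>u. L (u, 0))" and "l2 = Abs_alg_dual (\<lambda>v. - L (0, v))"
  have "linear (\<lambda>u. L (u, 0))" "linear (\<lambda>v. - L (0, v))"
    using linear_add[OF L(1), of "(_, 0)" "(_, 0)"] linear_scale[OF L(1), of _ "(_, 0)"]
      linear_add[OF L(1), of "(0, _)" "(0, _)"] linear_scale[OF L(1), of _ "(0, _)"]
    by (auto simp: linear_iff)
  then have f1: "form l1 u = L (u, 0)" and f2: "form l2 u = - L (0, u)" for u
    by (simp_all add: l1_def l2_def form_Abs)
  have "m = l1 - l2"
  proof (rule alg_dual_eqI)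
    fix u
    have "form m u = L ((u, 0) + (0, u))" using L(2)[of "(u, u)" "form m u"] by (simp add: G_def)
    also have "\<dots> = form (l1 - l2) u" by (simp only: linear_add[OF L(1)]) (simp add: f1 f2)
    finally show "form m u = form (l1 - l2) u" .
  qed
  moreover have "Phi_conj F l1 \<le> ereal 1" unfolding Phi_conj_le_iff
  proof
    fix u
    show "ereal (form l1 u) \<le> F u + ereal 1"
    proof (cases "F u")
      case (real r)
      then have "((u, 0), r + 1) \<in> E" using H_Phi_nonneg[of u] by (simp add: E_def H_Phi_zero)
      from L(3)[OF this] show ?thesis by (simp add: real f1)
    qed (use H_Phi_nonneg[of u] in auto)
  qed
  moreover have "Phi_conj F l2 \<le> ereal 1" unfolding Phi_conj_le_iff
  proof
    fix u
    show "ereal (form l2 u) \<le> F u + ereal 1"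
    proof (cases "F u")
      case (real r)
      then have "((0, - u), r + 1) \<in> E" using H_Phi_nonneg[of u] by (simp add: E_def H_Phi_zero)
      from L(3)[OF this] have "L (- (0, u)) \<le> r + 1" by simp
      then show ?thesis by (simp only: linear_neg[OF L(1)]) (simp add: real f2)
    qed (use H_Phi_nonneg[of u] in auto)
  qed
  ultimately have "m = l1 - l2" "l1 \<in> {l. Phi_conj F l < \<infinity>}" "l2 \<in> {l. Phi_conj F l < \<infinity>}"
    by auto
  then have "m \<in> span {l. Phi_conj F l < \<infinity>}"
    by (simp only: span_diff span_base)
  then have "K *\<^sub>R m \<in> span {l. Phi_conj F l < \<infinity>}" by (rule span_scale)
  then show "l \<in> span {l. Phi_conj F l < \<infinity>}" using K(1) by (simp add: m_def)
qed

end

section \<open>The conjugate of the transported function\<close>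

context
  fixes \<Phi> :: "'u::real_vector \<Rightarrow> ereal" and T :: "('u, 'y::real_vector) dual_op"
  assumes \<Phi>: "H_Phi \<Phi>" and T: "H_T T"
begin

text \<open>The definite description is meaningful: the range condition in \<open>H_T\<close> gives
  existence, and forms separate points.\<close>

lemma form_T_adj_U: "form l (T_adj_U T y) = form (T l) y"
proof -
  have "T_adj T y \<in> range (eval_on UNIV)" using T unfolding H_T_def by blast
  then obtain u where u: "eval_on UNIV u = T_adj T y" by (metis rangeE)
  have "v = u" if "eval_on UNIV v = T_adj T y" for v
  proof (rule form_separates)
    fix l show "form l v = form l u"
      using fun_cong[OF that, of l] fun_cong[OF u, of l] by (simp add: eval_on_def)
  qed
  with u have "eval_on UNIV (T_adj_U T y) = T_adj T y" unfolding T_adj_U_def by (rule theI)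
  from fun_cong[OF this, of l] show ?thesis by (simp add: eval_on_def T_adj_def)
qed

lemma linear_T_adj_U: "linear (T_adj_U T)"
  by (rule linearI; rule form_separates) (simp_all add: form_T_adj_U)

lemma T_adj_U_eq_0: "T_adj_U T y = 0 \<longleftrightarrow> y = 0"
proof
  assume 0: "T_adj_U T y = 0"
  have "T_adj T y = (\<lambda>_. 0)"
  proof
    fix l show "T_adj T y l = 0" using form_T_adj_U[of l y] 0 by (simp add: T_adj_def)
  qed
  then show "y = 0" using T by (auto simp: H_T_def)
qed (simp add: linear_0[OF linear_T_adj_U])

text \<open>All facts about an abstract \<open>F\<close> now apply to \<open>Lam\<close> as well.
  Nondegeneracy transfers because the adjoint has trivial kernel.\<close>

lemma H_Phi_Lam: "H_Phi (Lam \<Phi> T)"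
  using \<Phi> unfolding H_Phi_def Lam_def
  by (simp add: linear_add[OF linear_T_adj_U] linear_scale[OF linear_T_adj_U] linear_0[OF linear_T_adj_U] T_adj_U_eq_0)

lemma T_top_dual: "l \<in> top_dual \<Phi> \<Longrightarrow> T l \<in> top_dual (Lam \<Phi> T)"
  unfolding top_dual_iff[OF \<Phi>] top_dual_iff[OF H_Phi_Lam] Lam_def linear_neg[OF linear_T_adj_U]
  by (metis form_T_adj_U)

text \<open>Read on the range of the adjoint, \<open>form x\<close> is dominated by
  \<open>\<Phi> + r\<close>. A dominated extension to the whole space is a form that
  \<open>T\<close> sends to \<open>x\<close>, with the same bound on its conjugate.\<close>

lemma Phi_conj_Lam_attained:
  assumes "Phi_conj (Lam \<Phi> T) x \<le> ereal r"
  shows "\<exists>l. T l = x \<and> Phi_conj \<Phi> l \<le> ereal r"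
proof -
  define E where "E = {(u, s). \<Phi> u \<le> ereal (s - r)}"
  define G where "G = range (\<lambda>y. (T_adj_U T y, form x y))"
  have "convex E"
  proof (rule convexI)
    fix p q and a b :: real
    assume pq: "p \<in> E" "q \<in> E" and ab: "0 \<le> a" "0 \<le> b" "a + b = 1"
    have e: "a * (snd p - r) + b * (snd q - r) = (a * snd p + b * snd q) - r"
    proof -
      have b: "b = 1 - a" using ab by simp
      show ?thesis unfolding b by (simp add: algebra_simps)
    qed
    have "\<Phi> (a *\<^sub>R fst p + b *\<^sub>R fst q) \<le> ereal (a * (snd p - r) + b * (snd q - r))"
      using pq ab by (intro H_Phi_convex[OF \<Phi>]) (auto simp: E_def split: prod.splits)
    then show "a *\<^sub>R p + b *\<^sub>R q \<in> E" unfolding e by (cases p; cases q) (simp add: E_def)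
  qed
  moreover have "subspace G"
  proof -
    have "linear (\<lambda>y. (T_adj_U T y, form x y))"
      using linear_T_adj_U by (auto simp: linear_iff)
    then show ?thesis unfolding G_def by (intro linear_subspace_image subspace_UNIV)
  qed
  moreover have "a \<le> s" if us: "(u, a) \<in> G" "(u, s) \<in> E" for u a s
  proof -
    obtain y where y: "u = T_adj_U T y" "a = form x y" using us(1) by (auto simp: G_def)
    have "Lam \<Phi> T y \<le> ereal (s - r)" using us(2) y by (simp add: E_def Lam_def)
    from Phi_conj_leD[OF H_Phi_Lam assms this] show ?thesis using y by simp
  qed
  moreover have "\<exists>t>0. \<exists>s. (t *\<^sub>R u, s) \<in> E" for u
  proof -
    obtain t where t: "t > 0" "\<Phi> (t *\<^sub>R u) \<le> 1" using H_Phi_absorbing[OF \<Phi>, of u] by blast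
    then have "(t *\<^sub>R u, 1 + r) \<in> E" by (simp add: E_def one_ereal_def)
    with t show ?thesis by blast
  qed
  ultimately obtain L where L: "linear L" "\<And>u a. (u, a) \<in> G \<Longrightarrow> L u = a" "\<And>u s. (u, s) \<in> E \<Longrightarrow> L u \<le> s"
    using convex_domination_extension[of E G] by metis
  define l where "l = Abs_alg_dual L"
  have l: "form l u = L u" for u by (simp add: l_def form_Abs L(1))
  have "T l = x"
  proof (rule alg_dual_eqI)
    fix y
    have "(T_adj_U T y, form x y) \<in> G" by (simp add: G_def)
    from L(2)[OF this] show "form (T l) y = form x y" by (simp add: l flip: form_T_adj_U)
  qed
  moreover have "Phi_conj \<Phi> l \<le> ereal r" unfolding Phi_conj_le_iff[OF \<Phi>]
  proof
    fix u
    show "ereal (form l u) \<le> \<Phi> u + ereal r"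
    proof (cases "\<Phi> u")
      case (real s)
      then have "(u, s + r) \<in> E" by (simp add: E_def)
      from L(3)[OF this] show ?thesis by (simp add: real l)
    qed (use H_Phi_nonneg[OF \<Phi>, of u] in auto)
  qed
  ultimately show ?thesis by blast
qed

lemma Phi_conj_Lam_T_le: "Phi_conj (Lam \<Phi> T) (T l) \<le> Phi_conj \<Phi> l"
proof (cases "Phi_conj \<Phi> l < \<infinity>")
  case True
  then obtain r where r: "Phi_conj \<Phi> l = ereal r" by (rule Phi_conj_lessD[OF \<Phi>])
  have "Phi_conj (Lam \<Phi> T) (T l) \<le> ereal r" unfolding Phi_conj_le_iff[OF H_Phi_Lam]
    using r Phi_conj_le_iff[OF \<Phi>, of l r] by (simp add: Lam_def flip: form_T_adj_U)
  with r show ?thesis by simp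
qed simp

text \<open>The inequality \<open>Phi0 \<Phi> u \<le> \<Phi> u\<close> gives one direction. For the
  other, a preimage \<open>l\<close> of \<open>x\<close> with conjugate at most \<open>r\<close>
  provides an affine function \<open>form l - r\<close>, which is below \<open>Phi0\<close> by the
  definition of \<open>Phi0\<close>; pulled back along the adjoint it is
  \<open>form x - r\<close>.\<close>

lemma Lam0_conj_eq: "Lam0_conj \<Phi> T = Phi_conj (Lam \<Phi> T)"
proof
  fix x
  have le: "Phi0 \<Phi> u \<le> \<Phi> u" for u unfolding Phi0_def fenchel_conj_def
  proof (rule SUP_least)
    fix l
    show "ereal (form l u) - Phi_conj \<Phi> l \<le> \<Phi> u"
    proof (cases "Phi_conj \<Phi> l < \<infinity>")
      case True
      then obtain r where r: "Phi_conj \<Phi> l = ereal r" by (rule Phi_conj_lessD[OF \<Phi>])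
      then have "ereal (form l u) \<le> \<Phi> u + ereal r" using Phi_conj_le_iff[OF \<Phi>, of l r] by simp
      then show ?thesis unfolding r using H_Phi_nonneg[OF \<Phi>, of u] by (cases "\<Phi> u") auto
    qed (use H_Phi_nonneg[OF \<Phi>, of u] in auto)
  qed
  show "Lam0_conj \<Phi> T x = Phi_conj (Lam \<Phi> T) x"
  proof (rule antisym)
    show "Phi_conj (Lam \<Phi> T) x \<le> Lam0_conj \<Phi> T x"
      unfolding Lam0_conj_def Phi_conj_def fenchel_conj_def
      by (intro SUP_mono') (simp add: Lam0_def Lam_def le ereal_minus_mono)
    show "Lam0_conj \<Phi> T x \<le> Phi_conj (Lam \<Phi> T) x"
    proof (cases "Phi_conj (Lam \<Phi> T) x < \<infinity>")
      case True
      then obtain r where r: "Phi_conj (Lam \<Phi> T) x = ereal r" by (rule Phi_conj_lessD[OF H_Phi_Lam])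
      then obtain l where l: "T l = x" "Phi_conj \<Phi> l \<le> ereal r" using Phi_conj_Lam_attained by force
      show ?thesis unfolding Lam0_conj_def fenchel_conj_def r
      proof (rule SUP_least)
        fix y
        have "ereal (form x y) - ereal r = ereal (form l (T_adj_U T y)) - ereal r"
          by (simp add: form_T_adj_U l)
        also have "\<dots> \<le> ereal (form l (T_adj_U T y)) - Phi_conj \<Phi> l"
          by (intro ereal_minus_mono l order_refl)
        also have "\<dots> \<le> Lam0 \<Phi> T y" unfolding Lam0_def Phi0_def fenchel_conj_def by (rule SUP_upper) simp
        finally show "ereal (form x y) - Lam0 \<Phi> T y \<le> ereal r" by (cases "Lam0 \<Phi> T y") auto
      qed
    qed simp
  qed
qed

end

text \<open>Forms are handled here as plain functions, because on these the product topology is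
  pointwise convergence, whereas \<open>alg_dual\<close> has been given no topology.\<close>

lemma closed_dominated_linear:
  fixes F :: "'a::real_vector \<Rightarrow> ereal"
  shows "closed {h. linear h \<and> (\<forall>u. ereal (h u) \<le> F u + ereal r)}"
  unfolding linear_iff
  by (intro closed_Collect_conj closed_Collect_all closed_Collect_eq closed_Collect_le
      continuous_intros continuous_on_product_coordinates)

text \<open>The Banach-Alaoglu argument: a closed set inside a product of compact intervals. The
  interval at \<open>u\<close> comes from the ball estimate at a multiple of \<open>u\<close> in the
  unit ball.\<close>

lemma compact_dominated_linear:
  fixes F :: "'a::real_vector \<Rightarrow> ereal"
  assumes F: "H_Phi F"
  shows "compact {h. linear h \<and> (\<forall>u. ereal (h u) \<le> F u + ereal r)}" (is "compact ?S")
proof -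
  have "\<exists>b. \<forall>h\<in>?S. h u \<in> {- b..b}" for u
  proof -
    obtain \<alpha> where \<alpha>: "\<alpha> > 0" "F (\<alpha> *\<^sub>R u) \<le> 1" "F (- (\<alpha> *\<^sub>R u)) \<le> 1"
      using H_Phi_absorbing[OF F] by blast
    have "h u \<in> {- ((1 + r) / \<alpha>)..(1 + r) / \<alpha>}" if h: "h \<in> ?S" for h
    proof -
      have "Phi_conj F (Abs_alg_dual h) \<le> ereal r"
        using h by (simp add: Phi_conj_le_iff[OF F] form_Abs)
      from Phi_conj_le_ball[OF F this \<alpha>(2,3)] h have "\<bar>h u\<bar> \<le> (1 + r) / \<alpha>"
        using \<alpha>(1) by (simp add: form_Abs abs_mult field_simps)
      then show ?thesis unfolding atLeastAtMost_iff by linarith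
    qed
    then show ?thesis by (intro exI ballI)
  qed
  then have "\<exists>b. \<forall>u. \<forall>h\<in>?S. h u \<in> {- b u..b u}" by (intro choice allI)
  then obtain b where b: "\<forall>u. \<forall>h\<in>?S. h u \<in> {- b u..b u}" by (rule exE)
  have "compactin (product_topology (\<lambda>_. euclidean) UNIV) (PiE UNIV (\<lambda>u. {- b u..b u}))"
    by (simp add: compactin_PiE)
  then have "compact (PiE UNIV (\<lambda>u. {- b u..b u}))" by (simp add: euclidean_product_topology)
  moreover have "closed ?S" by (rule closed_dominated_linear)
  moreover have sub: "?S \<subseteq> PiE UNIV (\<lambda>u. {- b u..b u})"
  proof
    fix h assume "h \<in> ?S"
    with b have "h u \<in> {- b u..b u}" for u by blast
    then show "h \<in> PiE UNIV (\<lambda>u. {- b u..b u})" by (simp add: PiE_UNIV_domain)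
  qed
  ultimately have "compact (?S \<inter> PiE UNIV (\<lambda>u. {- b u..b u}))" by (intro closed_Int_compact)
  then show ?thesis by (simp only: inf.absorb1[OF sub])
qed

text \<open>On a sublevel set of the conjugate, every point of the completion is a uniform limit of
  evaluations; so there the weak topology of the pairing with the completion is no finer than
  pointwise convergence, for which the sublevel set is compact.\<close>

lemma continuous_completion_sublevel:
  fixes F :: "'a::real_vector \<Rightarrow> ereal"
  assumes F: "H_Phi F" and \<zeta>: "\<zeta> \<in> completion F"
  shows "continuous_on {h. linear h \<and> (\<forall>u. ereal (h u) \<le> F u + ereal r)} (\<lambda>h. \<zeta> (Abs_alg_dual h))"
    (is "continuous_on ?S _")
proof -
  obtain \<sigma> where \<sigma>: "Metric_space.MCauchy UNIV (lux_dist F) \<sigma>"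
    and lim: "\<And>l. l \<in> top_dual F \<Longrightarrow> (\<lambda>n. form l (\<sigma> n)) \<longlonglongrightarrow> \<zeta> l"
    using \<zeta> unfolding completion_def by blast
  interpret Metric_space UNIV "lux_dist F" by (rule Metric_space_lux_dist[OF F])
  \<comment> \<open>The sublevel set is equi-Lipschitz, so a Cauchy sequence of points converges
    uniformly over it. The absolute value of \<open>r\<close> keeps the constant positive.\<close>
  have lip: "\<bar>h u - h v\<bar> \<le> (1 + \<bar>r\<bar>) * lux_dist F u v" if h: "h \<in> ?S" for h u v
  proof -
    have "Phi_conj F (Abs_alg_dual h) \<le> ereal r"
      using h by (simp add: Phi_conj_le_iff[OF F] form_Abs)
    then have "Phi_conj F (Abs_alg_dual h) \<le> ereal \<bar>r\<bar>" by (rule order_trans) simp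
    then have "\<bar>form (Abs_alg_dual h) (u - v)\<bar> \<le> (1 + \<bar>r\<bar>) * lux_norm F (u - v)"
      by (intro form_le_lux_norm[OF F] Phi_conj_le_ball[OF F])
    then show ?thesis using h by (simp add: form_Abs linear_diff lux_dist_def)
  qed
  show ?thesis
  proof (rule uniform_limit_theorem)
    show "\<forall>\<^sub>F n in sequentially. continuous_on ?S (\<lambda>h. h (\<sigma> n))"
      by (intro always_eventually allI continuous_on_subset[OF continuous_on_product_coordinates]) simp
    show "uniform_limit ?S (\<lambda>n h. h (\<sigma> n)) (\<lambda>h. \<zeta> (Abs_alg_dual h)) sequentially"
    proof (rule uniform_limitI)
      fix e :: real assume e: "e > 0"
      then have "e / (2 * (1 + \<bar>r\<bar>)) > 0" by simp
      then obtain N where N: "\<And>n n'. N \<le> n \<Longrightarrow> N \<le> n' \<Longrightarrow> lux_dist F (\<sigma> n) (\<sigma> n') < e / (2 * (1 + \<bar>r\<bar>))"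
        using \<sigma> unfolding MCauchy_def by meson
      have "dist (h (\<sigma> n)) (\<zeta> (Abs_alg_dual h)) < e" if n: "n \<ge> N" and h: "h \<in> ?S" for n h
      proof -
        have "Phi_conj F (Abs_alg_dual h) \<le> ereal r"
          using h by (simp add: Phi_conj_le_iff[OF F] form_Abs)
        then have "Abs_alg_dual h \<in> top_dual F"
          by (rule Phi_conj_le_top_dual[OF F])
        from lim[OF this] h have "(\<lambda>k. h (\<sigma> k)) \<longlonglongrightarrow> \<zeta> (Abs_alg_dual h)" by (simp add: form_Abs)
        then have "(\<lambda>k. \<bar>h (\<sigma> n) - h (\<sigma> k)\<bar>) \<longlonglongrightarrow> \<bar>h (\<sigma> n) - \<zeta> (Abs_alg_dual h)\<bar>"
          by (intro tendsto_intros)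
        moreover have "\<exists>M. \<forall>k\<ge>M. \<bar>h (\<sigma> n) - h (\<sigma> k)\<bar> \<le> e / 2"
        proof (intro exI allI impI)
          fix k assume "k \<ge> N"
          have "\<bar>h (\<sigma> n) - h (\<sigma> k)\<bar> \<le> (1 + \<bar>r\<bar>) * lux_dist F (\<sigma> n) (\<sigma> k)" by (rule lip[OF h])
          also have "\<dots> \<le> (1 + \<bar>r\<bar>) * (e / (2 * (1 + \<bar>r\<bar>)))"
            using N[OF n \<open>k \<ge> N\<close>] by (intro mult_left_mono) auto
          also have "\<dots> = e / 2" by (simp add: field_simps add_eq_0_iff)
          finally show "\<bar>h (\<sigma> n) - h (\<sigma> k)\<bar> \<le> e / 2" .
        qed
        ultimately have "\<bar>h (\<sigma> n) - \<zeta> (Abs_alg_dual h)\<bar> \<le> e / 2" by (rule LIMSEQ_le_const2)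
        then show ?thesis using e by (simp add: dist_real_def)
      qed
      then show "\<forall>\<^sub>F n in sequentially. \<forall>h\<in>?S. dist (h (\<sigma> n)) (\<zeta> (Abs_alg_dual h)) < e"
        unfolding eventually_sequentially by blast
    qed
  qed simp
qed

text \<open>Finite intersections of the sets of points of \<open>K\<close> at levels above
  \<open>m\<close> are nonempty by \<open>near\<close>; compactness gives a common point, whose
  level is at most \<open>m\<close>.\<close>

lemma Phi_conj_attains_inf:
  fixes F :: "'a::real_vector \<Rightarrow> ereal"
  assumes F: "H_Phi F" and K: "closedin (weak_topology (top_dual F) (completion F) (\<lambda>x y. y x)) K"
    and near: "\<And>r. r > m \<Longrightarrow> \<exists>x\<in>K. Phi_conj F x \<le> ereal r"
  shows "\<exists>x\<in>K. Phi_conj F x \<le> ereal m"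
proof -
  define S where "S r = {h. linear h \<and> (\<forall>u. ereal (h u) \<le> F u + ereal r)}" for r
  have S_iff: "h \<in> S r \<longleftrightarrow> linear h \<and> Phi_conj F (Abs_alg_dual h) \<le> ereal r" for h r
    by (auto simp: S_def Phi_conj_le_iff[OF F] form_Abs)
  have cS: "compact (S r)" for r unfolding S_def by (rule compact_dominated_linear[OF F])
  have clS: "closed (S r)" for r unfolding S_def by (rule closed_dominated_linear)
  \<comment> \<open>\<open>K\<close> is closed only for the pairing with the completion. Its
    preimage is closed inside a fixed sublevel set, where that pairing is continuous;
    \<open>m + 1\<close> fixes one.\<close>
  define Z where "Z = {h \<in> S (m + 1). Abs_alg_dual h \<in> K}"
  have "closedin (top_of_set (S (m + 1))) {h \<in> topspace (top_of_set (S (m + 1))). Abs_alg_dual h \<in> K}"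
  proof (rule closedin_continuous_map_preimage[OF _ K])
    show "continuous_map (top_of_set (S (m + 1))) (weak_topology (top_dual F) (completion F) (\<lambda>x y. y x)) Abs_alg_dual"
      unfolding weak_topology_def
    proof (rule continuous_map_pullback')
      show "continuous_map (top_of_set (S (m + 1))) (powertop_real (completion F))
          ((\<lambda>x. \<lambda>y\<in>completion F. y x) \<circ> Abs_alg_dual)"
        using continuous_completion_sublevel[OF F]
        by (auto simp: continuous_map_componentwise comp_def S_def)
      show "topspace (top_of_set (S (m + 1))) \<subseteq> Abs_alg_dual -` top_dual F"
        by (auto simp: S_iff intro: Phi_conj_le_top_dual[OF F])
    qed
  qed
  then have "closed Z"
    using closedin_closed_trans[OF _ clS] by (simp add: Z_def)
  have "S (m + 1) \<inter> (\<Inter>r\<in>{m<..}. Z \<inter> S r) \<noteq> {}"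
  proof (rule compact_imp_fip_image[OF cS])
    show "closed (Z \<inter> S r)" for r by (intro closed_Int \<open>closed Z\<close> clS)
    fix R assume R: "finite R" "R \<subseteq> {m<..}"
    \<comment> \<open>Including \<open>m + 1\<close> puts the chosen point in \<open>Z\<close> and
      handles the empty family.\<close>
    define r where "r = Min (insert (m + 1) R)"
    have r: "r > m" "r \<le> m + 1" "\<And>s. s \<in> R \<Longrightarrow> r \<le> s"
      using R by (auto simp: r_def)
    then obtain x where x: "x \<in> K" "Phi_conj F x \<le> ereal r" using near by blast
    have "form x \<in> S s" if "r \<le> s" for s
      using order_trans[OF x(2), of "ereal s"] that by (simp add: S_iff linear_form form_inverse)
    then have "form x \<in> S (m + 1) \<inter> (\<Inter>r\<in>R. Z \<inter> S r)"
      using r x by (auto simp: Z_def form_inverse)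
    then show "S (m + 1) \<inter> (\<Inter>r\<in>R. Z \<inter> S r) \<noteq> {}" by blast
  qed
  then obtain h where h: "\<And>r. r > m \<Longrightarrow> h \<in> Z \<inter> S r" by auto
  have "h \<in> Z" using h[of "m + 1"] by simp
  then have "Abs_alg_dual h \<in> K" by (simp add: Z_def)
  moreover have "Phi_conj F (Abs_alg_dual h) \<le> ereal m"
  proof (rule ereal_le_epsilon2)
    fix e :: real assume "0 < e"
    then show "Phi_conj F (Abs_alg_dual h) \<le> ereal m + ereal e"
      using h[of "m + e"] by (simp add: S_iff)
  qed
  ultimately show ?thesis by blast
qed

section \<open>Multipliers and weak closures\<close>

context
  fixes F :: "'a::real_vector \<Rightarrow> ereal"
  assumes F: "H_Phi F"
begin

text \<open>A purely algebraic projection. Composing with it turns forms on the subspace into linear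
  maps on a whole type, as the extension and approximation theorems require.\<close>

lemma projection_top_dual:
  obtains \<pi> where "linear \<pi>" "\<And>x. \<pi> x \<in> top_dual F" "\<And>x. x \<in> top_dual F \<Longrightarrow> \<pi> x = x"
proof -
  have "\<exists>g. g ` UNIV \<subseteq> top_dual F \<and> linear g \<and> (\<forall>v\<in>top_dual F. g (id v) = v)"
    by (rule linear_exists_left_inverse_on[OF linear_id subspace_top_dual[OF F]]) simp
  then show thesis using that by auto
qed

text \<open>The value function \<open>z \<mapsto> inf {Phi_conj F (c + z); c \<in> K}\<close> on the norm dual has \<open>0\<close> in the
  core of its domain, because the affine hull of the domain of the conjugate is the whole norm
  dual; a multiplier is a subgradient of it at \<open>0\<close>.\<close>

lemma multiplier_exists:
  assumes K: "convex K" and x0: "x0 \<in> K" "x0 \<in> icor (dom_on UNIV (Phi_conj F))"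
    and lower: "\<And>x. x \<in> K \<Longrightarrow> ereal m \<le> Phi_conj F x"
    and sub: "K \<subseteq> top_dual F"
  obtains \<omega> where "\<omega> \<in> alg_dual_on (top_dual F)"
    "\<And>c x s. c \<in> K \<Longrightarrow> Phi_conj F x \<le> ereal s \<Longrightarrow> \<omega> x - \<omega> c \<le> s - m"
proof -
  obtain \<pi> where \<pi>: "linear \<pi>" "\<And>x. \<pi> x \<in> top_dual F" "\<And>x. x \<in> top_dual F \<Longrightarrow> \<pi> x = x"
    using projection_top_dual by blast
  \<comment> \<open>Epigraph of the value function lowered by \<open>m\<close>, with the
    perturbation read through \<pi>.\<close>
  define E where "E = {(z, r). \<exists>c\<in>K. Phi_conj F (c + \<pi> z) \<le> ereal (m + r)}"
  have "convex E"
  proof (rule convexI)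
    fix p q and a b :: real
    assume pq: "p \<in> E" "q \<in> E" and ab: "0 \<le> a" "0 \<le> b" "a + b = 1"
    obtain z r c where p: "p = (z, r)" "c \<in> K" "Phi_conj F (c + \<pi> z) \<le> ereal (m + r)"
      using pq(1) by (cases p) (auto simp: E_def)
    obtain z' r' c' where q: "q = (z', r')" "c' \<in> K" "Phi_conj F (c' + \<pi> z') \<le> ereal (m + r')"
      using pq(2) by (cases q) (auto simp: E_def)
    have "a *\<^sub>R c + b *\<^sub>R c' \<in> K" using K p q ab by (intro convexD) auto
    moreover have "Phi_conj F (a *\<^sub>R (c + \<pi> z) + b *\<^sub>R (c' + \<pi> z')) \<le> ereal (a * (m + r) + b * (m + r'))"
      using p q ab by (intro Phi_conj_convex[OF F]) auto
    moreover have "a *\<^sub>R (c + \<pi> z) + b *\<^sub>R (c' + \<pi> z')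
        = (a *\<^sub>R c + b *\<^sub>R c') + \<pi> (a *\<^sub>R z + b *\<^sub>R z')"
      by (simp add: linear_add[OF \<pi>(1)] linear_scale[OF \<pi>(1)] scaleR_add_right)
    moreover have "a * (m + r) + b * (m + r') = m + (a * r + b * r')"
    proof -
      have b: "b = 1 - a" using ab by simp
      show ?thesis unfolding b by (simp add: algebra_simps)
    qed
    ultimately have "(a *\<^sub>R z + b *\<^sub>R z', a * r + b * r') \<in> E" unfolding E_def by auto
    then show "a *\<^sub>R p + b *\<^sub>R q \<in> E" by (simp add: p(1) q(1))
  qed
  moreover have "a \<le> r" if zr: "(z, a) \<in> {0}" "(z, r) \<in> E" for z a r
  proof -
    have "z = 0" "a = 0" using zr(1) by (auto simp: zero_prod_def)
    then obtain c where "c \<in> K" "Phi_conj F c \<le> ereal (m + r)"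
      using zr(2) by (auto simp: E_def linear_0[OF \<pi>(1)])
    then have "ereal m \<le> ereal (m + r)" using lower order_trans by blast
    then show ?thesis using \<open>a = 0\<close> by simp
  qed
  moreover have "\<exists>t>0. \<exists>r. (t *\<^sub>R z, r) \<in> E" for z
  proof -
    \<comment> \<open>The conjugate vanishes at 0, so its domain contains 0 and the affine hull is
      the span.\<close>
    have hull: "affine hull (dom_on UNIV (Phi_conj F)) = span (dom_on UNIV (Phi_conj F))"
      by (rule affine_hull_span_0, rule hull_inc) (simp add: dom_on_def Phi_conj_zero[OF F])
    have dom: "dom_on UNIV (Phi_conj F) = {l. Phi_conj F l < \<infinity>}" by (simp add: dom_on_def)
    have x0d: "x0 \<in> dom_on UNIV (Phi_conj F)" using x0(2) by (simp add: icor_def)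
    have "\<pi> z \<in> span (dom_on UNIV (Phi_conj F))"
      using \<pi>(2) top_dual_span[OF F] unfolding dom by blast
    then have "x0 + \<pi> z \<in> affine hull (dom_on UNIV (Phi_conj F))"
      unfolding hull by (rule span_add[OF span_base[OF x0d]])
    then obtain t where t: "t > 0" "closed_segment x0 (x0 + t *\<^sub>R ((x0 + \<pi> z) - x0)) \<subseteq> dom_on UNIV (Phi_conj F)"
      using x0(2) unfolding icor_def by blast
    then have "Phi_conj F (x0 + \<pi> (t *\<^sub>R z)) < \<infinity>"
      using ends_in_segment(2)[of "x0 + t *\<^sub>R \<pi> z" x0]
      by (auto simp: dom_on_def linear_scale[OF \<pi>(1)])
    then obtain r where "Phi_conj F (x0 + \<pi> (t *\<^sub>R z)) = ereal r" by (rule Phi_conj_lessD[OF F])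
    then have "(t *\<^sub>R z, r - m) \<in> E" using x0(1) by (auto simp: E_def intro!: bexI[of _ x0])
    then show ?thesis using t(1) by blast
  qed
  ultimately obtain L where L: "linear L" "\<And>z r. (z, r) \<in> E \<Longrightarrow> L z \<le> r"
    using convex_domination_extension[of E "{0}"] subspace_single_0 by metis
  show thesis
  proof
    show "restrict L (top_dual F) \<in> alg_dual_on (top_dual F)"
      unfolding alg_dual_on_def using subspace_top_dual[OF F]
      by (auto simp: linear_add[OF L(1)] linear_scale[OF L(1)] subspace_add subspace_scale)
    fix c x s assume c: "c \<in> K" and x: "Phi_conj F x \<le> ereal s"
    have X: "c \<in> top_dual F" "x \<in> top_dual F"
      using c sub Phi_conj_le_top_dual[OF F x] by auto
    \<comment> \<open>The perturbation \<open>x - c\<close> carries \<open>c\<close> to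
      \<open>x\<close>, so the subgradient inequality relates two independent points.\<close>
    have "(x - c, s - m) \<in> E" unfolding E_def
      using c x \<pi>(3)[OF subspace_diff[OF subspace_top_dual[OF F] X(2,1)]]
      by (auto intro!: bexI[of _ c])
    from L(2)[OF this] show "restrict L (top_dual F) x - restrict L (top_dual F) c \<le> s - m"
      using X by (simp add: linear_diff[OF L(1)])
  qed
qed

text \<open>If \<open>form x\<close> is at most \<open>s\<close> on the domain of \<open>F\<close>,
  then \<open>t *\<^sub>R x\<close> has conjugate at most \<open>t * s\<close>. Letting
  \<open>t\<close> grow removes \<open>M\<close> and leaves \<open>\<omega> x \<le> s\<close>, the
  hypothesis of the finite-dimensional separation.\<close>

lemma evaluations_approximate:
  assumes \<omega>: "\<omega> \<in> alg_dual_on (top_dual F)"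
    and bnd: "\<And>x s. Phi_conj F x \<le> ereal s \<Longrightarrow> \<omega> x \<le> s + M"
    and G: "finite G" "G \<subseteq> top_dual F" and "\<epsilon> > 0"
  shows "\<exists>y. F y < \<infinity> \<and> (\<forall>x\<in>G. \<bar>form x y - \<omega> x\<bar> < \<epsilon>)"
proof -
  obtain \<pi> where \<pi>: "linear \<pi>" "\<And>x. \<pi> x \<in> top_dual F" "\<And>x. x \<in> top_dual F \<Longrightarrow> \<pi> x = x"
    using projection_top_dual by blast
  have add: "\<omega> (x + y) = \<omega> x + \<omega> y" if "x \<in> top_dual F" "y \<in> top_dual F" for x y
    using \<omega> that by (auto simp: alg_dual_on_def)
  have scale: "\<omega> (a *\<^sub>R x) = a * \<omega> x" if "x \<in> top_dual F" for x a
    using \<omega> that by (auto simp: alg_dual_on_def)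
  have W: "linear (\<lambda>x. \<omega> (\<pi> x))"
    by (intro linearI) (auto simp: linear_add[OF \<pi>(1)] linear_scale[OF \<pi>(1)] add scale \<pi>(2))
  have "\<exists>y\<in>{y. F y < \<infinity>}. \<forall>x\<in>G. \<bar>form x y - \<omega> (\<pi> x)\<bar> < \<epsilon>"
  proof (rule approximation_of_bounded_form[OF _ _ G(1) W \<open>\<epsilon> > 0\<close>])
    show "convex {y. F y < \<infinity>}"
    proof (rule convexI)
      fix x y and a b :: real
      assume xy: "x \<in> {y. F y < \<infinity>}" "y \<in> {y. F y < \<infinity>}" and ab: "0 \<le> a" "0 \<le> b" "a + b = 1"
      obtain r s where "F x = ereal r" "F y = ereal s"
        using xy H_Phi_nonneg[OF F, of x] H_Phi_nonneg[OF F, of y] by (cases "F x"; cases "F y") auto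
      then have "F (a *\<^sub>R x + b *\<^sub>R y) \<le> ereal (a * r + b * s)"
        using ab by (intro H_Phi_convex[OF F]) auto
      then show "a *\<^sub>R x + b *\<^sub>R y \<in> {y. F y < \<infinity>}" by auto
    qed
    show "{y. F y < \<infinity>} \<noteq> {}" using H_Phi_zero[OF F] by (auto intro: exI[of _ 0])
    fix x s assume x: "x \<in> span G" and s: "\<And>y. y \<in> {y. F y < \<infinity>} \<Longrightarrow> form x y \<le> s"
    have X: "x \<in> top_dual F" using x G(2) subspace_top_dual[OF F] span_minimal by blast
    have ray: "t * \<omega> x \<le> t * s + M" if t: "t > 0" for t
    proof -
      have "Phi_conj F (t *\<^sub>R x) \<le> ereal (t * s)" unfolding Phi_conj_le_iff[OF F]
      proof
        fix u
        show "ereal (form (t *\<^sub>R x) u) \<le> F u + ereal (t * s)"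
        proof (cases "F u")
          case (real r)
          then have "t * form x u \<le> t * s" "0 \<le> r"
            using t s[of u] H_Phi_nonneg[OF F, of u] by auto
          then show ?thesis by (simp add: real)
        qed (use H_Phi_nonneg[OF F, of u] in auto)
      qed
      from bnd[OF this] show ?thesis using scale[OF X] by simp
    qed
    have "\<omega> x \<le> s"
    proof (rule ccontr)
      assume "\<not> \<omega> x \<le> s"
      then have d: "\<omega> x - s > 0" by simp
      \<comment> \<open>The scale is chosen so that the excess \<open>t * (\<omega> x - s)\<close>
        equals \<open>\<bar>M\<bar> + 1\<close>.\<close>
      then have "(\<bar>M\<bar> + 1) / (\<omega> x - s) * (\<omega> x - s) \<le> M"
        using ray[of "(\<bar>M\<bar> + 1) / (\<omega> x - s)"] by (simp add: right_diff_distrib)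
      then show False using d by simp
    qed
    then show "\<omega> (\<pi> x) \<le> s" using \<pi>(3)[OF X] by simp
  qed
  then show ?thesis using \<pi>(3) G(2) by (metis (mono_tags, lifting) mem_Collect_eq subset_eq)
qed

end

lemma in_weak_closureI:
  assumes w: "w \<in> E" and A: "A \<subseteq> E"
    and approx: "\<And>G \<epsilon>. finite G \<Longrightarrow> G \<subseteq> F \<Longrightarrow> \<epsilon> > 0 \<Longrightarrow> \<exists>a\<in>A. \<forall>y\<in>G. \<bar>p a y - p w y\<bar> < \<epsilon>"
  shows "w \<in> weak_topology E F p closure_of A"
  unfolding in_closure_of
proof (intro conjI allI impI)
  show "w \<in> topspace (weak_topology E F p)"
    using w by (simp add: weak_topology_def topspace_pullback_topology)
  fix S assume S: "w \<in> S \<and> openin (weak_topology E F p) S"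
  then obtain U where U: "openin (powertop_real F) U" "S = (\<lambda>x. \<lambda>y\<in>F. p x y) -` U \<inter> E"
    by (auto simp: weak_topology_def openin_pullback_topology)
  then have "(\<lambda>y\<in>F. p w y) \<in> U" using S by auto
  from product_topology_open_contains_basis[OF U(1) this] obtain V
    where V: "(\<lambda>y\<in>F. p w y) \<in> PiE F V" "\<And>y. open (V y)" "finite {y. V y \<noteq> UNIV}" "PiE F V \<subseteq> U"
    by auto
  define G where "G = {y \<in> F. V y \<noteq> UNIV}"
  have G: "finite G" "G \<subseteq> F" using V(3) by (auto simp: G_def)
  have "\<exists>e>0. \<forall>a. \<bar>a - p w y\<bar> < e \<longrightarrow> a \<in> V y" if "y \<in> G" for y
  proof -
    have "p w y \<in> V y" using V(1) that G(2) by (auto simp: PiE_iff)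
    then show ?thesis using V(2)[of y] unfolding open_dist dist_real_def by blast
  qed
  then obtain e where e: "\<And>y. y \<in> G \<Longrightarrow> e y > 0" "\<And>y a. y \<in> G \<Longrightarrow> \<bar>a - p w y\<bar> < e y \<Longrightarrow> a \<in> V y"
    by metis
  \<comment> \<open>The extra 1 keeps the minimum defined when no coordinate is restricted.\<close>
  define \<epsilon> where "\<epsilon> = Min (insert 1 (e ` G))"
  have "\<epsilon> > 0" using e(1) G(1) by (auto simp: \<epsilon>_def)
  then obtain a where a: "a \<in> A" "\<And>y. y \<in> G \<Longrightarrow> \<bar>p a y - p w y\<bar> < \<epsilon>"
    using approx[OF G] by blast
  have "p a y \<in> V y" if "y \<in> F" for y
  proof (cases "y \<in> G")
    case True
    then have "\<epsilon> \<le> e y" using G(1) by (auto simp: \<epsilon>_def)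
    with a(2)[OF True] show ?thesis by (intro e(2)[OF True]) linarith
  qed (use that in \<open>simp add: G_def\<close>)
  then have "(\<lambda>y\<in>F. p a y) \<in> U" using V(4) by (auto simp: subset_iff)
  then show "\<exists>y. y \<in> A \<and> y \<in> S" using a(1) A U(2) by auto
qed

section \<open>The bidual functions and optimality\<close>

lemma alg_dual_on_add: "\<zeta> \<in> alg_dual_on S \<Longrightarrow> x \<in> S \<Longrightarrow> y \<in> S \<Longrightarrow> \<zeta> (x + y) = \<zeta> x + \<zeta> y"
  and alg_dual_on_scale: "\<zeta> \<in> alg_dual_on S \<Longrightarrow> x \<in> S \<Longrightarrow> \<zeta> (a *\<^sub>R x) = a * \<zeta> x"
  by (auto simp: alg_dual_on_def)

lemma alg_dual_on_zero: "\<zeta> \<in> alg_dual_on S \<Longrightarrow> 0 \<in> S \<Longrightarrow> \<zeta> 0 = 0"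
  using alg_dual_on_scale[of \<zeta> S 0 0] by simp

lemma alg_dual_on_diff:
  "\<zeta> \<in> alg_dual_on S \<Longrightarrow> \<xi> \<in> alg_dual_on S \<Longrightarrow> subspace S \<Longrightarrow> (\<lambda>x\<in>S. \<zeta> x - \<xi> x) \<in> alg_dual_on S"
  unfolding alg_dual_on_def by (auto simp: subspace_add subspace_scale algebra_simps)

lemma eval_on_alg_dual_on: "subspace S \<Longrightarrow> eval_on S u \<in> alg_dual_on S"
  unfolding alg_dual_on_def eval_on_def by (auto simp: subspace_add subspace_scale)

lemma Phi2_cong: "(\<And>l. l \<in> L1 F \<Longrightarrow> \<zeta> l = \<xi> l) \<Longrightarrow> Phi2 F \<zeta> = Phi2 F \<xi>"
  unfolding Phi2_def fenchel_conj_def by (intro SUP_cong) auto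

lemma Phi1_eq_Phi2: "Phi1 F = Phi2 F"
  by (simp add: Phi1_def Phi2_def)

context
  fixes F :: "'a::real_vector \<Rightarrow> ereal"
  assumes F: "H_Phi F"
begin

lemma eval_on_completion: "eval_on (top_dual F) u \<in> completion F"
proof -
  interpret Metric_space UNIV "lux_dist F" by (rule Metric_space_lux_dist[OF F])
  have "MCauchy (\<lambda>_. u)" by (simp add: MCauchy_def)
  then show ?thesis unfolding completion_def
    using eval_on_alg_dual_on[OF subspace_top_dual[OF F], of u]
    by (auto simp: eval_on_def intro!: exI[of _ "\<lambda>_. u"])
qed

text \<open>The right side needs no membership in \<open>L1\<close>: a finite conjugate implies
  it.\<close>

lemma Phi2_le_iff: "Phi2 F \<zeta> \<le> ereal M \<longleftrightarrow> (\<forall>l s. Phi_conj F l \<le> ereal s \<longrightarrow> \<zeta> l \<le> s + M)"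
proof
  assume le: "Phi2 F \<zeta> \<le> ereal M"
  show "\<forall>l s. Phi_conj F l \<le> ereal s \<longrightarrow> \<zeta> l \<le> s + M"
  proof (intro allI impI)
    fix l s assume l: "Phi_conj F l \<le> ereal s"
    have "ereal (\<zeta> l) - ereal s \<le> ereal (\<zeta> l) - Phi_conj F l" by (intro ereal_minus_mono l order_refl)
    also have "\<dots> \<le> Phi2 F \<zeta>" unfolding Phi2_def fenchel_conj_def L1_def
      by (rule SUP_upper) (rule Phi_conj_le_top_dual[OF F l])
    also note le
    finally show "\<zeta> l \<le> s + M" by simp
  qed
next
  assume *: "\<forall>l s. Phi_conj F l \<le> ereal s \<longrightarrow> \<zeta> l \<le> s + M"
  show "Phi2 F \<zeta> \<le> ereal M" unfolding Phi2_def fenchel_conj_def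
  proof (rule SUP_least)
    fix l
    show "ereal (\<zeta> l) - Phi_conj F l \<le> ereal M"
    proof (cases "Phi_conj F l < \<infinity>")
      case True
      then obtain r where "Phi_conj F l = ereal r" by (rule Phi_conj_lessD[OF F])
      moreover from this have "\<zeta> l \<le> r + M" using * by simp
      ultimately show ?thesis by simp
    qed simp
  qed
qed

lemma Phi2_nonneg: "\<zeta> \<in> L1_alg F \<Longrightarrow> 0 \<le> Phi2 F \<zeta>"
  unfolding Phi2_def fenchel_conj_def L1_alg_def L1_def
  by (rule SUP_upper2[OF subspace_0[OF subspace_top_dual[OF F]]])
    (simp add: alg_dual_on_zero subspace_0[OF subspace_top_dual[OF F]] Phi_conj_zero[OF F])

lemma Phi2_eval_on_le: "Phi2 F (eval_on (L1 F) u) \<le> F u"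
proof (cases "F u")
  case (real r)
  show ?thesis unfolding real Phi2_le_iff
  proof (intro allI impI)
    fix l s assume l: "Phi_conj F l \<le> ereal s"
    have "l \<in> L1 F" unfolding L1_def by (rule Phi_conj_le_top_dual[OF F l])
    then show "eval_on (L1 F) u l \<le> s + r"
      using Phi_conj_leD[OF F l, of u r] real by (simp add: eval_on_def add.commute)
  qed
qed (use H_Phi_nonneg[OF F, of u] in auto)

text \<open>For a subgradient, testing at evaluations of points \<open>u\<close> is enough: there
  \<open>Phi2\<close> is at most \<open>F u\<close>, so the inequality bounds the conjugate of
  \<open>l\<close>. Conversely, the supremum defining \<open>Phi2\<close> at the shifted point is
  tested at \<open>l\<close> itself.\<close>

lemma subdiff_Phi2_iff_Young:
  assumes l: "l \<in> L1 F" and \<zeta>: "\<zeta> \<in> L1_alg F"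
  shows "l \<in> subdiff_Phi2 F \<zeta> \<longleftrightarrow> Phi_conj F l + Phi2 F \<zeta> = ereal (\<zeta> l)"
proof -
  have sub: "subspace (L1 F)" unfolding L1_def by (rule subspace_top_dual[OF F])
  have diff: "(\<lambda>m\<in>L1 F. \<xi> m - \<zeta> m) \<in> L1_alg F" if "\<xi> \<in> L1_alg F" for \<xi>
    using that \<zeta> sub unfolding L1_alg_def by (intro alg_dual_on_diff)
  have shift: "Phi2 F (\<lambda>m\<in>L1 F. \<zeta> m + (\<lambda>m\<in>L1 F. \<xi> m - \<zeta> m) m) = Phi2 F \<xi>" for \<xi>
    by (rule Phi2_cong) simp
  show ?thesis
  proof
    assume sd: "l \<in> subdiff_Phi2 F \<zeta>"
    have "Phi2 F \<xi> \<ge> Phi2 F \<zeta> + ereal (\<xi> l - \<zeta> l)" if "\<xi> \<in> L1_alg F" for \<xi>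
    proof -
      have "Phi2 F (\<lambda>m\<in>L1 F. \<zeta> m + (\<lambda>m\<in>L1 F. \<xi> m - \<zeta> m) m)
          \<ge> Phi2 F \<zeta> + ereal ((\<lambda>m\<in>L1 F. \<xi> m - \<zeta> m) l)"
        using sd diff[OF that] unfolding subdiff_Phi2_def by blast
      then show ?thesis unfolding shift using l by simp
    qed
    then have ev: "F u \<ge> Phi2 F \<zeta> + ereal (form l u - \<zeta> l)" for u
      using order_trans[OF _ Phi2_eval_on_le[of u]] eval_on_alg_dual_on[OF sub, of u] l
      by (fastforce simp: L1_alg_def eval_on_def)
    \<comment> \<open>The test at \<open>u = 0\<close> excludes an infinite value of
      \<open>Phi2\<close> at \<zeta>.\<close>
    obtain M where M: "Phi2 F \<zeta> = ereal M"
      using ev[of 0] H_Phi_zero[OF F] Phi2_nonneg[OF \<zeta>] by (cases "Phi2 F \<zeta>") auto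
    have "Phi_conj F l \<le> ereal (\<zeta> l - M)" unfolding Phi_conj_le_iff[OF F]
    proof
      fix u
      show "ereal (form l u) \<le> F u + ereal (\<zeta> l - M)"
        using ev[of u] M H_Phi_nonneg[OF F, of u] by (cases "F u") auto
    qed
    moreover from this obtain s where s: "Phi_conj F l = ereal s"
      using Phi_conj_nonneg[OF F, of l] by (cases "Phi_conj F l") auto
    moreover have "\<zeta> l \<le> s + M" using Phi2_le_iff[of \<zeta> M] M s by simp
    ultimately show "Phi_conj F l + Phi2 F \<zeta> = ereal (\<zeta> l)" using M by simp
  next
    assume Y: "Phi_conj F l + Phi2 F \<zeta> = ereal (\<zeta> l)"
    then obtain s M where s: "Phi_conj F l = ereal s" and M: "Phi2 F \<zeta> = ereal M"
      using Phi_conj_nonneg[OF F, of l] Phi2_nonneg[OF \<zeta>]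
      by (cases "Phi_conj F l"; cases "Phi2 F \<zeta>") auto
    have "Phi2 F (\<lambda>m\<in>L1 F. \<zeta> m + \<xi> m) \<ge> Phi2 F \<zeta> + ereal (\<xi> l)" for \<xi>
    proof -
      have "ereal (\<zeta> l + \<xi> l) - Phi_conj F l \<le> Phi2 F (\<lambda>m\<in>L1 F. \<zeta> m + \<xi> m)"
        unfolding Phi2_def fenchel_conj_def by (rule SUP_upper2[OF l]) (simp add: l)
      moreover have "\<zeta> l + \<xi> l - s = M + \<xi> l" using Y s M by simp
      ultimately show ?thesis using s M by simp
    qed
    then show "l \<in> subdiff_Phi2 F \<zeta>" using l by (auto simp: subdiff_Phi2_def)
  qed
qed

end

section \<open>Transport of the bidual functions by the adjoint\<close>

context
  fixes \<Phi> :: "'u::real_vector \<Rightarrow> ereal" and T :: "('u, 'y::real_vector) dual_op"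
  assumes \<Phi>: "H_Phi \<Phi>" and T: "H_T T"
begin

lemma subspace_L1: "subspace (L1 \<Phi>)"
  unfolding L1_def by (rule subspace_top_dual[OF \<Phi>])

lemma T_in_X1: "l \<in> L1 \<Phi> \<Longrightarrow> T l \<in> X1 \<Phi> T"
  unfolding L1_def X1_def by (rule T_top_dual[OF \<Phi> T])

text \<open>\<open>Lam2\<close> is the Fenchel conjugate of the conjugate of \<open>Lam\<close>:
  each \<open>x\<close> has a preimage under \<open>T\<close> with the same bound, and
  \<open>T\<close> never increases the conjugate.\<close>

lemma Lam2_le_iff:
  "Lam2 \<Phi> T \<omega> \<le> ereal M \<longleftrightarrow> (\<forall>x s. Phi_conj (Lam \<Phi> T) x \<le> ereal s \<longrightarrow> \<omega> x \<le> s + M)"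
proof -
  have "Lam2 \<Phi> T \<omega> \<le> ereal M \<longleftrightarrow> (\<forall>l s. Phi_conj \<Phi> l \<le> ereal s \<longrightarrow> \<omega> (T l) \<le> s + M)"
    unfolding Lam2_def Phi2_le_iff[OF \<Phi>] T2_adj_def
    using Phi_conj_le_top_dual[OF \<Phi>] by (auto simp: L1_def)
  also have "\<dots> \<longleftrightarrow> (\<forall>x s. Phi_conj (Lam \<Phi> T) x \<le> ereal s \<longrightarrow> \<omega> x \<le> s + M)"
  proof (intro iffI allI impI)
    fix x s assume *: "\<forall>l s. Phi_conj \<Phi> l \<le> ereal s \<longrightarrow> \<omega> (T l) \<le> s + M"
      and "Phi_conj (Lam \<Phi> T) x \<le> ereal s"
    from Phi_conj_Lam_attained[OF \<Phi> T this(2)]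
    obtain l where "T l = x" "Phi_conj \<Phi> l \<le> ereal s" by blast
    with * show "\<omega> x \<le> s + M" by blast
  next
    fix l s assume *: "\<forall>x s. Phi_conj (Lam \<Phi> T) x \<le> ereal s \<longrightarrow> \<omega> x \<le> s + M"
      and "Phi_conj \<Phi> l \<le> ereal s"
    from order_trans[OF Phi_conj_Lam_T_le[OF \<Phi> T] this(2)] * show "\<omega> (T l) \<le> s + M" by blast
  qed
  finally show ?thesis .
qed

lemma T2_adj_L1_alg:
  assumes "linear T" "\<omega> \<in> X1_alg \<Phi> T"
  shows "T2_adj \<Phi> T \<omega> \<in> L1_alg \<Phi>"
  using assms subspace_L1 T_in_X1
  unfolding T2_adj_def L1_alg_def X1_alg_def alg_dual_on_def
  by (auto simp: linear_add linear_scale subspace_add subspace_scale)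

lemma Y1_subset_X1_alg: "Y1 \<Phi> T \<subseteq> X1_alg \<Phi> T"
  by (auto simp: Y1_def X1_alg_def X1_def completion_def)

lemma eval_on_Y1: "eval_on (X1 \<Phi> T) y \<in> Y1 \<Phi> T"
  unfolding X1_def Y1_def by (rule eval_on_completion[OF H_Phi_Lam[OF \<Phi> T]])

lemma T1_adj_eval_on: "T1_adj \<Phi> T (eval_on (X1 \<Phi> T) y) = eval_on (L1 \<Phi>) (T_adj_U T y)"
  using eval_on_Y1[of y] T_in_X1
  by (auto simp: T1_adj_def T2_adj_def eval_on_def form_T_adj_U[OF \<Phi> T] fun_eq_iff)

lemma Lam1_eval_on_le: "Lam1 \<Phi> T (eval_on (X1 \<Phi> T) y) \<le> Lam \<Phi> T y"
  unfolding Lam1_def T1_adj_eval_on Phi1_eq_Phi2 Lam_def by (rule Phi2_eval_on_le[OF \<Phi>])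

lemma eval_on_dom_Lam1: "Lam \<Phi> T y < \<infinity> \<Longrightarrow> eval_on (X1 \<Phi> T) y \<in> dom_on (Y1 \<Phi> T) (Lam1 \<Phi> T)"
  using Lam1_eval_on_le[of y] eval_on_Y1[of y] by (auto simp: dom_on_def)

text \<open>Evaluations at points of the original space compete in the supremum over
  \<open>Y1\<close>, and \<open>Lam1\<close> is at most \<open>Lam\<close> on them. This transfers
  finiteness from \<open>Lam1_conj\<close>.\<close>

lemma Phi_conj_Lam_le_Lam1_conj:
  assumes "x \<in> X1 \<Phi> T"
  shows "Phi_conj (Lam \<Phi> T) x \<le> Lam1_conj \<Phi> T x"
  unfolding Phi_conj_def[of "Lam \<Phi> T"] fenchel_conj_def
proof (rule SUP_least)
  fix y
  have "ereal (form x y) - Lam \<Phi> T y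
      \<le> ereal (eval_on (X1 \<Phi> T) y x) - Lam1 \<Phi> T (eval_on (X1 \<Phi> T) y)"
    using assms Lam1_eval_on_le by (intro ereal_minus_mono) (auto simp: eval_on_def)
  also have "\<dots> \<le> Lam1_conj \<Phi> T x"
    unfolding Lam1_conj_def fenchel_conj_def by (rule SUP_upper[OF eval_on_Y1])
  finally show "ereal (form x y) - Lam \<Phi> T y \<le> Lam1_conj \<Phi> T x" .
qed

text \<open>The same points \<open>y\<close> with finite \<open>Lam\<close> serve all three
  closures: their evaluations lie in the domain of \<open>Lam1\<close>, \<open>T1_adj\<close> turns
  these into evaluations at \<open>T_adj_U T y\<close>, and these points lie in the domain of
  \<Phi>.\<close>

lemma weak_closures_of_dom:
  assumes lin: "linear T" and \<omega>: "\<omega> \<in> X1_alg \<Phi> T" and M: "Lam2 \<Phi> T \<omega> \<le> ereal M"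
  shows "\<omega> \<in> weak_topology (X1_alg \<Phi> T) (X1 \<Phi> T) (\<lambda>\<omega> x. \<omega> x) closure_of dom_on (Y1 \<Phi> T) (Lam1 \<Phi> T)"
    and "T2_adj \<Phi> T \<omega> \<in> weak_topology (L1_alg \<Phi>) (L1 \<Phi>) (\<lambda>\<zeta> l. \<zeta> l) closure_of
      T1_adj \<Phi> T ` dom_on (Y1 \<Phi> T) (Lam1 \<Phi> T)"
    and "T2_adj \<Phi> T \<omega> \<in> weak_topology (L1_alg \<Phi>) (L1 \<Phi>) (\<lambda>\<zeta> l. \<zeta> l) closure_of
      eval_on (L1 \<Phi>) ` dom_on UNIV \<Phi>"
proof -
  have approx: "\<exists>y. Lam \<Phi> T y < \<infinity> \<and> (\<forall>x\<in>G. \<bar>form x y - \<omega> x\<bar> < \<epsilon>)"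
    if "finite G" "G \<subseteq> X1 \<Phi> T" "\<epsilon> > 0" for G \<epsilon>
    using evaluations_approximate[OF H_Phi_Lam[OF \<Phi> T], of \<omega> M G \<epsilon>] \<omega> M that
    by (simp add: X1_alg_def X1_def Lam2_le_iff)
  have approxT: "\<exists>y. Lam \<Phi> T y < \<infinity> \<and> (\<forall>l\<in>G. \<bar>form l (T_adj_U T y) - T2_adj \<Phi> T \<omega> l\<bar> < \<epsilon>)"
    if G: "finite G" "G \<subseteq> L1 \<Phi>" "\<epsilon> > 0" for G \<epsilon>
    using approx[of "T ` G" \<epsilon>] G T_in_X1
    by (force simp: form_T_adj_U[OF \<Phi> T] T2_adj_def)
  show "\<omega> \<in> weak_topology (X1_alg \<Phi> T) (X1 \<Phi> T) (\<lambda>\<omega> x. \<omega> x) closure_of dom_on (Y1 \<Phi> T) (Lam1 \<Phi> T)"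
  proof (rule in_weak_closureI[OF \<omega>])
    show "dom_on (Y1 \<Phi> T) (Lam1 \<Phi> T) \<subseteq> X1_alg \<Phi> T"
      using Y1_subset_X1_alg by (auto simp: dom_on_def)
    fix G :: "'y alg_dual set" and \<epsilon> :: real assume G: "finite G" "G \<subseteq> X1 \<Phi> T" "\<epsilon> > 0"
    then obtain y where y: "Lam \<Phi> T y < \<infinity>" "\<forall>x\<in>G. \<bar>form x y - \<omega> x\<bar> < \<epsilon>" using approx by blast
    then show "\<exists>a\<in>dom_on (Y1 \<Phi> T) (Lam1 \<Phi> T). \<forall>x\<in>G. \<bar>a x - \<omega> x\<bar> < \<epsilon>"
      using G(2) by (intro bexI[OF _ eval_on_dom_Lam1[OF y(1)]]) (auto simp: eval_on_def)
  qed
  note T2 = T2_adj_L1_alg[OF lin \<omega>]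
  show "T2_adj \<Phi> T \<omega> \<in> weak_topology (L1_alg \<Phi>) (L1 \<Phi>) (\<lambda>\<zeta> l. \<zeta> l) closure_of
      T1_adj \<Phi> T ` dom_on (Y1 \<Phi> T) (Lam1 \<Phi> T)"
  proof (rule in_weak_closureI[OF T2])
    show "T1_adj \<Phi> T ` dom_on (Y1 \<Phi> T) (Lam1 \<Phi> T) \<subseteq> L1_alg \<Phi>"
      using T2_adj_L1_alg[OF lin] Y1_subset_X1_alg by (auto simp: dom_on_def T1_adj_def)
    fix G :: "'u alg_dual set" and \<epsilon> :: real assume G: "finite G" "G \<subseteq> L1 \<Phi>" "\<epsilon> > 0"
    then obtain y where y: "Lam \<Phi> T y < \<infinity>" "\<forall>l\<in>G. \<bar>form l (T_adj_U T y) - T2_adj \<Phi> T \<omega> l\<bar> < \<epsilon>"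
      using approxT by blast
    then show "\<exists>a\<in>T1_adj \<Phi> T ` dom_on (Y1 \<Phi> T) (Lam1 \<Phi> T). \<forall>l\<in>G. \<bar>a l - T2_adj \<Phi> T \<omega> l\<bar> < \<epsilon>"
      using G(2) by (intro bexI[OF _ imageI[OF eval_on_dom_Lam1[OF y(1)]]])
        (unfold T1_adj_eval_on, auto simp: eval_on_def)
  qed
  show "T2_adj \<Phi> T \<omega> \<in> weak_topology (L1_alg \<Phi>) (L1 \<Phi>) (\<lambda>\<zeta> l. \<zeta> l) closure_of
      eval_on (L1 \<Phi>) ` dom_on UNIV \<Phi>"
  proof (rule in_weak_closureI[OF T2])
    show "eval_on (L1 \<Phi>) ` dom_on UNIV \<Phi> \<subseteq> L1_alg \<Phi>"
      using eval_on_alg_dual_on[OF subspace_L1] by (auto simp: L1_alg_def)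
    fix G :: "'u alg_dual set" and \<epsilon> :: real assume G: "finite G" "G \<subseteq> L1 \<Phi>" "\<epsilon> > 0"
    then obtain y where y: "Lam \<Phi> T y < \<infinity>" "\<forall>l\<in>G. \<bar>form l (T_adj_U T y) - T2_adj \<Phi> T \<omega> l\<bar> < \<epsilon>"
      using approxT by blast
    then have "T_adj_U T y \<in> dom_on UNIV \<Phi>" by (simp add: dom_on_def Lam_def)
    then show "\<exists>a\<in>eval_on (L1 \<Phi>) ` dom_on UNIV \<Phi>. \<forall>l\<in>G. \<bar>a l - T2_adj \<Phi> T \<omega> l\<bar> < \<epsilon>"
      using G(2) y(2) by (intro bexI[OF _ imageI]) (auto simp: eval_on_def)
  qed
qed

text \<open>Young's inequality at \<open>x\<^sub>o + d\<close> bounds \<omega> by a constant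
  \<open>k\<close> on the level set. A gauge below \<open>\<epsilon> / k\<close> writes the point as
  a multiple of some \<open>d\<close> by a factor below \<open>\<epsilon> / k\<close>.\<close>

lemma gauge_semicontinuity:
  assumes \<omega>: "\<omega> \<in> X1_alg \<Phi> T" and M: "Lam2 \<Phi> T \<omega> \<le> ereal M"
    and xo: "x\<^sub>o \<in> dom_on (X1 \<Phi> T) (Lam1_conj \<Phi> T)"
  shows "usc_at_0 (X1 \<Phi> T) (gauge_of (level_set \<Phi> T x\<^sub>o)) \<omega>"
    and "lsc_at_0 (X1 \<Phi> T) (gauge_of (uminus ` level_set \<Phi> T x\<^sub>o)) \<omega>"
proof -
  have xX: "x\<^sub>o \<in> X1 \<Phi> T" using xo by (simp add: dom_on_def)
  have "Phi_conj (Lam \<Phi> T) x\<^sub>o < \<infinity>"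
    using xo Phi_conj_Lam_le_Lam1_conj[OF xX] by (auto simp: dom_on_def)
  then obtain r where r: "Phi_conj (Lam \<Phi> T) x\<^sub>o = ereal r"
    by (rule Phi_conj_lessD[OF H_Phi_Lam[OF \<Phi> T]])
  have \<omega>': "\<omega> \<in> alg_dual_on (X1 \<Phi> T)" using \<omega> by (simp add: X1_alg_def)
  \<comment> \<open>Young's inequality gives \<open>r + 1 + M - \<omega> x\<^sub>o\<close>, with
    \<open>r + 1\<close> the level of the set; the absolute value and the final 1 make
    \<open>k\<close> positive.\<close>
  define k where "k = \<bar>r + 1 + M - \<omega> x\<^sub>o\<bar> + 1"
  have k: "\<omega> d \<le> k" if d: "d \<in> level_set \<Phi> T x\<^sub>o" for d
  proof -
    have "Phi_conj (Lam \<Phi> T) (x\<^sub>o + d) \<le> ereal (r + 1)"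
      using d r by (simp add: level_set_def Lam0_conj_eq[OF \<Phi> T] one_ereal_def)
    then have "\<omega> (x\<^sub>o + d) \<le> r + 1 + M" using M unfolding Lam2_le_iff by blast
    then show ?thesis using alg_dual_on_add[OF \<omega>' xX, of d] d by (simp add: level_set_def k_def)
  qed
  have small: "\<exists>\<alpha> d. 0 < \<alpha> \<and> \<alpha> < \<delta> \<and> d \<in> D \<and> x = \<alpha> *\<^sub>R d" if "gauge_of D x < ereal \<delta>"
    for D :: "'y alg_dual set" and x \<delta>
    using that unfolding gauge_of_def INF_less_iff by auto
  have bnd: "\<alpha> * \<omega> d < \<epsilon>" if "0 < \<alpha>" "\<alpha> < \<epsilon> / k" "d \<in> level_set \<Phi> T x\<^sub>o" for \<alpha> \<epsilon> d
  proof -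
    have "\<alpha> * \<omega> d \<le> \<alpha> * k" using that k by (intro mult_left_mono) auto
    also have "\<dots> < \<epsilon>" using that by (simp add: k_def field_simps)
    finally show ?thesis .
  qed
  have k0: "k > 0" by (simp add: k_def)
  have DX: "d \<in> X1 \<Phi> T" if "d \<in> level_set \<Phi> T x\<^sub>o" for d using that by (simp add: level_set_def)
  show "usc_at_0 (X1 \<Phi> T) (gauge_of (level_set \<Phi> T x\<^sub>o)) \<omega>" unfolding usc_at_0_def
  proof (intro allI impI)
    fix \<epsilon> :: real assume "\<epsilon> > 0"
    have "\<omega> x < \<epsilon>" if x: "gauge_of (level_set \<Phi> T x\<^sub>o) x < ereal (\<epsilon> / k)" for x
    proof -
      obtain \<alpha> d where "0 < \<alpha>" "\<alpha> < \<epsilon> / k" "d \<in> level_set \<Phi> T x\<^sub>o" "x = \<alpha> *\<^sub>R d"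
        using small[OF x] by blast
      with bnd[of \<alpha> \<epsilon> d] show ?thesis using alg_dual_on_scale[OF \<omega>' DX] by simp
    qed
    then show "\<exists>\<delta>>0. \<forall>x\<in>X1 \<Phi> T. gauge_of (level_set \<Phi> T x\<^sub>o) x < ereal \<delta> \<longrightarrow> \<omega> x < \<epsilon>"
      using \<open>\<epsilon> > 0\<close> k0 by (intro exI[of _ "\<epsilon> / k"]) auto
  qed
  show "lsc_at_0 (X1 \<Phi> T) (gauge_of (uminus ` level_set \<Phi> T x\<^sub>o)) \<omega>" unfolding lsc_at_0_def
  proof (intro allI impI)
    fix \<epsilon> :: real assume "\<epsilon> > 0"
    have "\<omega> x > - \<epsilon>" if x: "gauge_of (uminus ` level_set \<Phi> T x\<^sub>o) x < ereal (\<epsilon> / k)" for x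
    proof -
      obtain \<alpha> d where \<alpha>: "0 < \<alpha>" "\<alpha> < \<epsilon> / k" "d \<in> level_set \<Phi> T x\<^sub>o" "x = (- \<alpha>) *\<^sub>R d"
        using small[OF x] by auto
      have "\<omega> x = - \<alpha> * \<omega> d" unfolding \<alpha>(4) by (rule alg_dual_on_scale[OF \<omega>' DX[OF \<alpha>(3)]])
      with bnd[OF \<alpha>(1-3)] show ?thesis by simp
    qed
    then show "\<exists>\<delta>>0. \<forall>x\<in>X1 \<Phi> T. gauge_of (uminus ` level_set \<Phi> T x\<^sub>o) x < ereal \<delta> \<longrightarrow> \<omega> x > - \<epsilon>"
      using \<open>\<epsilon> > 0\<close> k0 by (intro exI[of _ "\<epsilon> / k"]) auto
  qed
qed

end

theorem theorem2p9:
  fixes \<Phi> :: "'u::real_vector \<Rightarrow> ereal"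
    and T :: "'u alg_dual \<Rightarrow> 'y::real_vector alg_dual"
    and C :: "'y alg_dual set"
  assumes "linear T" and "convex C"
    and "H_Phi \<Phi>" and "H_T T" and "H_C \<Phi> T C"
    and "C \<inter> icor (dom_on UNIV (Lam0_conj \<Phi> T)) \<noteq> {}"
  shows
    \<comment> \<open>(a)\<close>
    "((\<exists>l\<in>L1 \<Phi>. solution_P \<Phi> T C l) \<and> (\<exists>\<omega>\<in>X1_alg \<Phi> T. solution_D2 \<Phi> T C \<omega>))
    \<and>
    \<comment> \<open>(b)\<close>
    ((\<forall>l\<in>L1 \<Phi>. solution_P \<Phi> T C l \<longleftrightarrow>
        (\<exists>\<omega>\<in>X1_alg \<Phi> T. T l \<in> C \<and> (\<forall>x\<in>C1 \<Phi> T C. \<omega> (T l) \<le> \<omega> x)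
           \<and> l \<in> subdiff_Phi2 \<Phi> (T2_adj \<Phi> T \<omega>)))
     \<and> (\<forall>l\<in>L1 \<Phi>. \<forall>\<omega>\<in>X1_alg \<Phi> T.
          (T l \<in> C \<and> (\<forall>x\<in>C1 \<Phi> T C. \<omega> (T l) \<le> \<omega> x) \<and> l \<in> subdiff_Phi2 \<Phi> (T2_adj \<Phi> T \<omega>))
          \<longleftrightarrow> (solution_P \<Phi> T C l \<and> solution_D2 \<Phi> T C \<omega> \<and> inf_P \<Phi> T C = sup_D2 \<Phi> T C))
     \<and> (\<forall>l\<in>L1 \<Phi>. \<forall>\<omega>\<in>X1_alg \<Phi> T.
          l \<in> subdiff_Phi2 \<Phi> (T2_adj \<Phi> T \<omega>)
          \<longleftrightarrow> Phi_conj \<Phi> l + Phi2 \<Phi> (T2_adj \<Phi> T \<omega>) = ereal (\<omega> (T l))))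
    \<and>
    \<comment> \<open>(c)\<close>
    (\<forall>\<omega>. solution_D2 \<Phi> T C \<omega> \<longrightarrow>
        \<omega> \<in> (weak_topology (X1_alg \<Phi> T) (X1 \<Phi> T) (\<lambda>\<omega> x. \<omega> x)) closure_of
               (dom_on (Y1 \<Phi> T) (Lam1 \<Phi> T))
      \<and> T2_adj \<Phi> T \<omega> \<in> (weak_topology (L1_alg \<Phi>) (L1 \<Phi>) (\<lambda>\<zeta> l. \<zeta> l)) closure_of
               (T1_adj \<Phi> T ` dom_on (Y1 \<Phi> T) (Lam1 \<Phi> T))
      \<and> T2_adj \<Phi> T \<omega> \<in> (weak_topology (L1_alg \<Phi>) (L1 \<Phi>) (\<lambda>\<zeta> l. \<zeta> l)) closure_of
               (eval_on (L1 \<Phi>) ` dom_on UNIV \<Phi>)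
      \<and> (\<forall>x\<^sub>o \<in> C \<inter> icor (dom_on (X1 \<Phi> T) (Lam1_conj \<Phi> T)).
            usc_at_0 (X1 \<Phi> T) (gauge_of (level_set \<Phi> T x\<^sub>o)) \<omega>
          \<and> lsc_at_0 (X1 \<Phi> T) (gauge_of (uminus ` level_set \<Phi> T x\<^sub>o)) \<omega>))"
proof -
  note \<Phi> = \<open>H_Phi \<Phi>\<close> and T = \<open>H_T T\<close> and lin = \<open>linear T\<close>
  note \<Lambda> = H_Phi_Lam[OF \<Phi> T]
  define f where "f = Phi_conj (Lam \<Phi> T)"
  define K where "K = C1 \<Phi> T C"
  have f_X1: "x \<in> X1 \<Phi> T" if "f x \<le> ereal s" for x s
    using that Phi_conj_le_top_dual[OF \<Lambda>] by (simp add: f_def X1_def)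
  have conj_L1: "l \<in> L1 \<Phi>" if "Phi_conj \<Phi> l \<le> ereal s" for l s
    using that Phi_conj_le_top_dual[OF \<Phi>] by (simp add: L1_def)
  have K_iff: "x \<in> K \<longleftrightarrow> x \<in> C \<and> x \<in> X1 \<Phi> T" for x by (simp add: K_def C1_def)

  \<comment> \<open>Primal value and attainment\<close>
  obtain x0 where x0: "x0 \<in> C" "x0 \<in> icor (dom_on UNIV f)"
    using \<open>C \<inter> icor _ \<noteq> {}\<close> by (auto simp: f_def Lam0_conj_eq[OF \<Phi> T])
  have "f x0 < \<infinity>" using x0(2) by (simp add: icor_def dom_on_def)
  then obtain r0 where r0: "f x0 = ereal r0" unfolding f_def by (rule Phi_conj_lessD[OF \<Lambda>])
  then have x0K: "x0 \<in> K" using x0(1) f_X1[of x0 r0] by (simp add: K_iff)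
  have "0 \<le> (INF x\<in>K. f x)" unfolding f_def by (intro INF_greatest Phi_conj_nonneg[OF \<Lambda>])
  moreover have "(INF x\<in>K. f x) \<le> ereal r0" using r0 x0K by (metis INF_lower)
  ultimately obtain m where m: "(INF x\<in>K. f x) = ereal m" by (cases "INF x\<in>K. f x") auto
  have mK: "ereal m \<le> f x" if "x \<in> K" for x unfolding m[symmetric] using that by (rule INF_lower)
  have "\<exists>x\<in>K. f x \<le> ereal m" unfolding f_def
  proof (rule Phi_conj_attains_inf[OF \<Lambda>])
    show "closedin (weak_topology (top_dual (Lam \<Phi> T)) (completion (Lam \<Phi> T)) (\<lambda>x y. y x)) K"
      using \<open>H_C \<Phi> T C\<close> by (simp add: H_C_def K_def X1_def Y1_def)
    fix r assume "r > m"
    then have "(INF x\<in>K. f x) < ereal r" using m by simp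
    then show "\<exists>x\<in>K. Phi_conj (Lam \<Phi> T) x \<le> ereal r"
      unfolding INF_less_iff f_def by (auto intro: less_imp_le)
  qed
  then obtain x1 where x1: "x1 \<in> K" "f x1 \<le> ereal m" by blast
  obtain l1 where l1: "T l1 = x1" "Phi_conj \<Phi> l1 \<le> ereal m"
    using Phi_conj_Lam_attained[OF \<Phi> T, of x1 m] x1(2) by (auto simp: f_def)
  \<comment> \<open>A feasible \<open>l\<close> of finite cost has its image in \<open>X1\<close>,
    hence in \<open>K\<close>, so minimizing over all forms loses nothing against
    \<open>K\<close>.\<close>
  have lower: "ereal m \<le> Phi_conj \<Phi> l" if "T l \<in> C" for l
  proof (cases "Phi_conj \<Phi> l < \<infinity>")
    case True
    then obtain s where s: "Phi_conj \<Phi> l = ereal s" by (rule Phi_conj_lessD[OF \<Phi>])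
    have le: "f (T l) \<le> ereal s" using Phi_conj_Lam_T_le[OF \<Phi> T, of l] by (simp add: f_def s)
    then have "T l \<in> K" using that f_X1 by (simp add: K_iff)
    from order_trans[OF mK[OF this] le] show ?thesis by (simp add: s)
  qed simp
  have infP: "inf_P \<Phi> T C = ereal m"
  proof (rule antisym)
    have "l1 \<in> feasible_P T C" using l1(1) x1(1) by (simp add: feasible_P_def K_iff)
    then show "inf_P \<Phi> T C \<le> ereal m" unfolding inf_P_def by (rule INF_lower2) (rule l1(2))
    show "ereal m \<le> inf_P \<Phi> T C"
      unfolding inf_P_def by (rule INF_greatest) (simp add: lower feasible_P_def)
  qed
  have solP_iff: "solution_P \<Phi> T C l \<longleftrightarrow> T l \<in> C \<and> Phi_conj \<Phi> l \<le> ereal m" for l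
    using lower[of l] by (auto simp: solution_P_def infP feasible_P_def)

  \<comment> \<open>Dual value and attainment\<close>
  have Lam2_nonneg: "0 \<le> Lam2 \<Phi> T \<omega>" if "\<omega> \<in> X1_alg \<Phi> T" for \<omega>
    unfolding Lam2_def by (rule Phi2_nonneg[OF \<Phi> T2_adj_L1_alg[OF \<Phi> T lin that]])
  \<comment> \<open>The infimum over \<open>K\<close> is at most \<open>\<omega> x0\<close>, hence
    not \<infinity>; so a real lower bound on the objective forces \<open>Lam2\<close> to be
    finite.\<close>
  have obj: "objective_D2 \<Phi> T C \<omega> \<ge> ereal a \<longleftrightarrow> (\<exists>M. Lam2 \<Phi> T \<omega> = ereal M \<and> (\<forall>c\<in>K. a + M \<le> \<omega> c))"
    if \<omega>: "\<omega> \<in> X1_alg \<Phi> T" for \<omega> a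
  proof -
    have "(INF x\<in>K. ereal (\<omega> x)) \<le> ereal (\<omega> x0)" using x0K by (rule INF_lower)
    then have ninf: "(INF x\<in>K. ereal (\<omega> x)) \<noteq> \<infinity>" by auto
    show ?thesis
    proof (cases "Lam2 \<Phi> T \<omega>")
      case (real M)
      have "ereal a \<le> (INF x\<in>K. ereal (\<omega> x)) - ereal M \<longleftrightarrow> ereal (a + M) \<le> (INF x\<in>K. ereal (\<omega> x))"
        using ninf by (cases "INF x\<in>K. ereal (\<omega> x)") auto
      then show ?thesis by (simp add: objective_D2_def K_def[symmetric] real le_INF_iff)
    next
      case PInf
      then show ?thesis using ninf
        by (cases "INF x\<in>K. ereal (\<omega> x)") (auto simp: objective_D2_def K_def[symmetric])
    qed (use Lam2_nonneg[OF \<omega>] in auto)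
  qed
  have Fenchel: "\<omega> x \<le> s + M" if "Lam2 \<Phi> T \<omega> = ereal M" "f x \<le> ereal s" for \<omega> M x s
    using that Lam2_le_iff[OF \<Phi> T, of \<omega> M] by (simp add: f_def)
  \<comment> \<open>The minimizer \<open>x1\<close> is tested: a dual value above \<open>m\<close>
    would give \<open>a + M \<le> \<omega> x1 \<le> m + M\<close> with \<open>m < a\<close>.\<close>
  have weak: "objective_D2 \<Phi> T C \<omega> \<le> ereal m" if \<omega>: "\<omega> \<in> X1_alg \<Phi> T" for \<omega>
  proof (rule ccontr)
    assume "\<not> objective_D2 \<Phi> T C \<omega> \<le> ereal m"
    then obtain a where a: "m < a" "ereal a \<le> objective_D2 \<Phi> T C \<omega>"
      using ereal_dense2[of "ereal m" "objective_D2 \<Phi> T C \<omega>"] by (auto simp: not_le)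
    then obtain M where M: "Lam2 \<Phi> T \<omega> = ereal M" "\<forall>c\<in>K. a + M \<le> \<omega> c" using obj[OF \<omega>] by blast
    then show False using Fenchel[OF M(1) x1(2)] x1(1) a(1) by force
  qed
  have "convex K" using \<open>H_C \<Phi> T C\<close> by (simp add: H_C_def K_def)
  then obtain \<omega>0 where \<omega>0: "\<omega>0 \<in> X1_alg \<Phi> T"
    and mult: "\<And>c x s. c \<in> K \<Longrightarrow> f x \<le> ereal s \<Longrightarrow> \<omega>0 x - \<omega>0 c \<le> s - m"
    using multiplier_exists[OF \<Lambda>, of K x0 m] x0K x0(2) mK K_iff
    unfolding f_def X1_alg_def X1_def by (metis subsetI)
  have opt0: "ereal m \<le> objective_D2 \<Phi> T C \<omega>0"
  proof -
    \<comment> \<open>For fixed \<open>c\<close> the multiplier inequality reads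
      \<open>\<omega>0 x \<le> s + (\<omega>0 c - m)\<close>, which is a bound on
      \<open>Lam2\<close>.\<close>
    have le: "Lam2 \<Phi> T \<omega>0 \<le> ereal (\<omega>0 c - m)" if "c \<in> K" for c
      unfolding Lam2_le_iff[OF \<Phi> T] using mult[OF that] by (force simp: f_def)
    obtain M where M: "Lam2 \<Phi> T \<omega>0 = ereal M"
      using le[OF x0K] Lam2_nonneg[OF \<omega>0] by (cases "Lam2 \<Phi> T \<omega>0") auto
    moreover have "m + M \<le> \<omega>0 c" if "c \<in> K" for c using le[OF that] M by simp
    ultimately show ?thesis using obj[OF \<omega>0] by blast
  qed
  have supD: "sup_D2 \<Phi> T C = ereal m"
  proof (rule antisym)
    show "sup_D2 \<Phi> T C \<le> ereal m" unfolding sup_D2_def by (rule SUP_least) (rule weak)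
    show "ereal m \<le> sup_D2 \<Phi> T C" unfolding sup_D2_def by (rule SUP_upper2, rule \<omega>0, rule opt0)
  qed
  have solD_iff: "solution_D2 \<Phi> T C \<omega> \<longleftrightarrow>
      \<omega> \<in> X1_alg \<Phi> T \<and> (\<exists>M. Lam2 \<Phi> T \<omega> = ereal M \<and> (\<forall>c\<in>K. m + M \<le> \<omega> c))" for \<omega>
    using obj[of \<omega> m] weak[of \<omega>] by (auto simp: solution_D2_def supD)

  \<comment> \<open>Optimality conditions\<close>
  have young: "l \<in> subdiff_Phi2 \<Phi> (T2_adj \<Phi> T \<omega>)
      \<longleftrightarrow> Phi_conj \<Phi> l + Phi2 \<Phi> (T2_adj \<Phi> T \<omega>) = ereal (\<omega> (T l))"
    if "l \<in> L1 \<Phi>" "\<omega> \<in> X1_alg \<Phi> T" for l \<omega>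
    using subdiff_Phi2_iff_Young[OF \<Phi> that(1) T2_adj_L1_alg[OF \<Phi> T lin that(2)]] that(1)
    by (simp add: T2_adj_def)
  \<comment> \<open>The equality of the two values is already established. Forward, Young's identity
    and minimality at \<open>T l\<close> give a dual value at least the cost of \<open>l\<close>,
    and weak duality closes the gap. Backward, \<open>\<omega> (T l)\<close> is squeezed to
    \<open>m + M\<close>, which yields both minimality and Young's identity.\<close>
  have optimality: "T l \<in> C \<and> (\<forall>x\<in>C1 \<Phi> T C. \<omega> (T l) \<le> \<omega> x) \<and> l \<in> subdiff_Phi2 \<Phi> (T2_adj \<Phi> T \<omega>)
      \<longleftrightarrow> solution_P \<Phi> T C l \<and> solution_D2 \<Phi> T C \<omega>"
    if l: "l \<in> L1 \<Phi>" and \<omega>: "\<omega> \<in> X1_alg \<Phi> T" for l \<omega>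
  proof
    assume *: "T l \<in> C \<and> (\<forall>x\<in>C1 \<Phi> T C. \<omega> (T l) \<le> \<omega> x) \<and> l \<in> subdiff_Phi2 \<Phi> (T2_adj \<Phi> T \<omega>)"
    then have Y: "Phi_conj \<Phi> l + Lam2 \<Phi> T \<omega> = ereal (\<omega> (T l))"
      using young[OF l \<omega>] by (simp add: Lam2_def)
    then obtain s M where s: "Phi_conj \<Phi> l = ereal s" and M: "Lam2 \<Phi> T \<omega> = ereal M"
      using Phi_conj_nonneg[OF \<Phi>, of l] Lam2_nonneg[OF \<omega>]
      by (cases "Phi_conj \<Phi> l"; cases "Lam2 \<Phi> T \<omega>") auto
    have "s + M = \<omega> (T l)" using Y s M by simp
    then have c: "s + M \<le> \<omega> c" if "c \<in> K" for c using * that by (simp add: K_def)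
    then have "ereal s \<le> objective_D2 \<Phi> T C \<omega>" using obj[OF \<omega>] M by blast
    then have "ereal s \<le> ereal m" using weak[OF \<omega>] by (rule order_trans)
    moreover have "m \<le> s" using lower[of l] * s by simp
    ultimately have "s = m" by simp
    then show "solution_P \<Phi> T C l \<and> solution_D2 \<Phi> T C \<omega>"
      using * s M c \<omega> by (simp add: solP_iff solD_iff)
  next
    assume sol: "solution_P \<Phi> T C l \<and> solution_D2 \<Phi> T C \<omega>"
    then obtain M where M: "Lam2 \<Phi> T \<omega> = ereal M" "\<And>c. c \<in> K \<Longrightarrow> m + M \<le> \<omega> c"
      by (auto simp: solD_iff)
    have Tl: "T l \<in> C" "Phi_conj \<Phi> l \<le> ereal m" using sol by (auto simp: solP_iff)
    have TlK: "T l \<in> K" using Tl T_in_X1[OF \<Phi> T l] by (simp add: K_iff)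
    have "f (T l) \<le> ereal m"
      using Phi_conj_Lam_T_le[OF \<Phi> T, of l] Tl(2) unfolding f_def by (rule order_trans)
    then have eq: "\<omega> (T l) = m + M" using Fenchel[OF M(1)] M(2)[OF TlK] by force
    have "Phi_conj \<Phi> l = ereal m" using Tl lower by (intro antisym)
    then have "l \<in> subdiff_Phi2 \<Phi> (T2_adj \<Phi> T \<omega>)"
      using young[OF l \<omega>] M(1) eq by (simp add: Lam2_def)
    then show "T l \<in> C \<and> (\<forall>x\<in>C1 \<Phi> T C. \<omega> (T l) \<le> \<omega> x) \<and> l \<in> subdiff_Phi2 \<Phi> (T2_adj \<Phi> T \<omega>)"
      using Tl(1) eq M(2) by (simp add: K_def)
  qed
  have sol0: "solution_D2 \<Phi> T C \<omega>0" using obj[OF \<omega>0] opt0 \<omega>0 by (simp add: solD_iff)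
  have sol1: "solution_P \<Phi> T C l1" "l1 \<in> L1 \<Phi>"
    using l1 x1(1) conj_L1 by (auto simp: solP_iff K_iff)

  have b1: "\<forall>l\<in>L1 \<Phi>. solution_P \<Phi> T C l \<longleftrightarrow>
      (\<exists>\<omega>\<in>X1_alg \<Phi> T. T l \<in> C \<and> (\<forall>x\<in>C1 \<Phi> T C. \<omega> (T l) \<le> \<omega> x)
         \<and> l \<in> subdiff_Phi2 \<Phi> (T2_adj \<Phi> T \<omega>))"
  proof (intro ballI iffI)
    fix l assume l: "l \<in> L1 \<Phi>" and "solution_P \<Phi> T C l"
    then show "\<exists>\<omega>\<in>X1_alg \<Phi> T. T l \<in> C \<and> (\<forall>x\<in>C1 \<Phi> T C. \<omega> (T l) \<le> \<omega> x)
         \<and> l \<in> subdiff_Phi2 \<Phi> (T2_adj \<Phi> T \<omega>)"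
      using optimality[OF l \<omega>0] sol0 \<omega>0 by blast
  next
    fix l assume l: "l \<in> L1 \<Phi>" and "\<exists>\<omega>\<in>X1_alg \<Phi> T. T l \<in> C \<and> (\<forall>x\<in>C1 \<Phi> T C. \<omega> (T l) \<le> \<omega> x)
         \<and> l \<in> subdiff_Phi2 \<Phi> (T2_adj \<Phi> T \<omega>)"
    then show "solution_P \<Phi> T C l" using optimality[OF l] by blast
  qed

  \<comment> \<open>Properties of dual solutions\<close>
  have c: "\<omega> \<in> (weak_topology (X1_alg \<Phi> T) (X1 \<Phi> T) (\<lambda>\<omega> x. \<omega> x)) closure_of
               (dom_on (Y1 \<Phi> T) (Lam1 \<Phi> T))
      \<and> T2_adj \<Phi> T \<omega> \<in> (weak_topology (L1_alg \<Phi>) (L1 \<Phi>) (\<lambda>\<zeta> l. \<zeta> l)) closure_of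
               (T1_adj \<Phi> T ` dom_on (Y1 \<Phi> T) (Lam1 \<Phi> T))
      \<and> T2_adj \<Phi> T \<omega> \<in> (weak_topology (L1_alg \<Phi>) (L1 \<Phi>) (\<lambda>\<zeta> l. \<zeta> l)) closure_of
               (eval_on (L1 \<Phi>) ` dom_on UNIV \<Phi>)
      \<and> (\<forall>x\<^sub>o \<in> C \<inter> icor (dom_on (X1 \<Phi> T) (Lam1_conj \<Phi> T)).
            usc_at_0 (X1 \<Phi> T) (gauge_of (level_set \<Phi> T x\<^sub>o)) \<omega>
          \<and> lsc_at_0 (X1 \<Phi> T) (gauge_of (uminus ` level_set \<Phi> T x\<^sub>o)) \<omega>)"
    if sol: "solution_D2 \<Phi> T C \<omega>" for \<omega>
  proof -
    obtain M where \<omega>: "\<omega> \<in> X1_alg \<Phi> T" and M: "Lam2 \<Phi> T \<omega> \<le> ereal M"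
      using sol unfolding solD_iff by (metis order_refl)
    show ?thesis
      by (intro conjI ballI weak_closures_of_dom[OF \<Phi> T lin \<omega> M] gauge_semicontinuity[OF \<Phi> T \<omega> M])
        (auto simp: icor_def)
  qed
  show ?thesis
    using sol0 \<omega>0 sol1 b1 optimality young c by (simp add: infP supD) blast
qed

end
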